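(* Let $K:\mathbb{R}^d\times\mathbb{R}^d\to\mathbb{R}$ be a kernel function which is shift-invariant (i.e. $K(x,y)=K(x-y)$, normalized so that $K(0)=1$) and analytic at the origin, with feature mapping $\varphi:\mathbb{R}^d\to\mathcal{H}$ into a Hilbert space $\mathcal{H}$. There are constants depending only on $K$ such that the following holds. For every $0<\delta\le\epsilon\le 2^{-16}$ and every $d,D\in\mathbb{N}$ with $D\ge\max\{\Theta(\epsilon^{-1}\log^3(1/\delta)),\Theta(\epsilon^{-2}\log(1/\delta))\}$, if $\pi:\mathbb{R}^d\to\mathbb{R}^D$ is the RFF mapping for $K$ with target dimension $D$, then for every $x,y\in\mathbb{R}^d$, \[\Pr\big[\,|\mathrm{dist}_\pi(x,y)-\mathrm{dist}_\varphi(x,y)|\le\epsilon\cdot\mathrm{dist}_\varphi(x,y)\,\big]\ge1-\delta.\]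
   Context: $K$ is analytic at the origin if there is $r>0$ such that $K$ (viewed as a function of $x-y\in\mathbb{R}^d$) is analytic on $\{x\in\mathbb{R}^d:\|x\|_1<r\}$. Let $p$ be the probability density on $\mathbb{R}^d$ (Bochner's theorem) with $K(x)=\int p(\omega)e^{\mathrm{i}\langle\omega,x\rangle}\,d\omega$. The RFF mapping with target dimension $D$ is $\pi(x)=\sqrt{1/D}\,(\sin\langle\omega_1,x\rangle,\cos\langle\omega_1,x\rangle,\dots,\sin\langle\omega_D,x\rangle,\cos\langle\omega_D,x\rangle)$ with $\omega_1,\dots,\omega_D$ i.i.d. of density $p$. $\mathrm{dist}_f(x,y)=\|f(x)-f(y)\|_2$; $\mathrm{dist}_\varphi(x,y)=\sqrt{2-2K(x-y)}$. The $\Theta(\cdot)$ in the lower bound for $D$ hides constants depending on $K$. *)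

theory Defs
  imports "HOL-Probability.Probability"
begin

definition l1_norm :: "'a::euclidean_space \<Rightarrow> real" where
  "l1_norm x = (\<Sum>b\<in>Basis. \<bar>x \<bullet> b\<bar>)"

definition multi_indices :: "('a::euclidean_space \<Rightarrow> nat) set" where
  "multi_indices = {\<alpha>. \<forall>b. b \<notin> Basis \<longrightarrow> \<alpha> b = 0}"

definition monomial_at :: "('a::euclidean_space \<Rightarrow> nat) \<Rightarrow> 'a \<Rightarrow> real" where
  "monomial_at \<alpha> x = (\<Prod>b\<in>Basis. (x \<bullet> b) ^ \<alpha> b)"

definition analytic_at_origin :: "('a::euclidean_space \<Rightarrow> real) \<Rightarrow> bool" where
  "analytic_at_origin K \<longleftrightarrow>
     (\<exists>r>0. \<exists>c :: ('a \<Rightarrow> nat) \<Rightarrow> real.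
        \<forall>x. l1_norm x < r \<longrightarrow>
          ((\<lambda>\<alpha>. c \<alpha> * monomial_at \<alpha> x) has_sum K x) multi_indices)"

definition rff_map :: "nat \<Rightarrow> (nat \<Rightarrow> 'a::euclidean_space) \<Rightarrow> 'a \<Rightarrow> nat \<Rightarrow> real" where
  "rff_map D w x j =
     (if j < 2 * D then
        sqrt (1 / real D) *
          (if even j then sin (w (j div 2) \<bullet> x) else cos (w (j div 2) \<bullet> x))
      else 0)"

definition dist_rff :: "nat \<Rightarrow> (nat \<Rightarrow> 'a::euclidean_space) \<Rightarrow> 'a \<Rightarrow> 'a \<Rightarrow> real" where
  "dist_rff D w x y = sqrt (\<Sum>j<2 * D. (rff_map D w x j - rff_map D w y j)\<^sup>2)"

text \<open>dist_phi(x,y) = || phi(x) - phi(y) || = sqrt(2 - 2 K(x - y)).\<close>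
definition dist_feature :: "('a::euclidean_space \<Rightarrow> real) \<Rightarrow> 'a \<Rightarrow> 'a \<Rightarrow> real" where
  "dist_feature K x y = sqrt (2 - 2 * K (x - y))"

definition rff_measure :: "nat \<Rightarrow> ('a::euclidean_space \<Rightarrow> real) \<Rightarrow> (nat \<Rightarrow> 'a) measure" where
  "rff_measure D p = PiM {..<D} (\<lambda>_. density lborel (\<lambda>w. ennreal (p w)))"

end

(* Put z = x - y and \<mu> = 1 - K z. Up to the factor 2 \<mu>, the squared RFF distance is the mean of D
   independent copies of Y = (1 - cos (w . z)) / \<mu>, which has expectation 1, so everything reduces to
   concentration of that mean, uniformly in z.

   Since the spectral measure has a density, \<mu> \<ge> c min 1 |z|^2, whence Y \<le> (2/c) (1 + |w|^2). Analyticity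
   of K at the origin bounds the even moments of w along each axis by Taylor coefficients of K, hence
   gives E exp (a |w|) < \<infinity>. So E exp (b sqrt Y) is bounded independently of z, and truncating Y at a
   multiple of ln(1/\<delta>)^2 turns a Chernoff bound for the truncated part and Markov's inequality for
   the rest into the two lower bounds on D. *)

theory Submission
  imports Defs
begin

section \<open>Lower bound for the spectral gap\<close>

text \<open>The bound on 1 - K z has to hold at both ends. For large z it must not return to 0, and
  this is where the density matters: with atoms K can come back to 1. For small z it must shrink no
  faster than |z|^2, and this is inherited from large z by passing to an integer multiple of z.
  After truncation at T the Chernoff parameter is capped twice. The cap 1/T asks for D of order T
  ln(1/\<delta>) / \<epsilon>, which is the cubed logarithm because T is of order ln(1/\<delta>)^2;
  the cap of order \<epsilon>, which comes from the second moment, asks for ln(1/\<delta>) /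
  \<epsilon>^2. The discarded part has mean at most \<delta>^2 / 8, and \<delta> \<le> \<epsilon> is
  what makes Markov's inequality at level \<epsilon> / 2 return a multiple of \<delta>.\<close>

lemma abs_sin_of_nat_mult_le: "\<bar>sin (real n * x)\<bar> \<le> real n * \<bar>sin x\<bar>"
proof (induction n)
  case (Suc n)
  have "\<bar>sin (real (Suc n) * x)\<bar> = \<bar>sin (real n * x) * cos x + cos (real n * x) * sin x\<bar>"
    by (simp only: of_nat_Suc distrib_right mult_1 add.commute[of 1] sin_add)
  also have "\<dots> \<le> \<bar>sin (real n * x)\<bar> * \<bar>cos x\<bar> + \<bar>cos (real n * x)\<bar> * \<bar>sin x\<bar>"
    by (simp add: abs_mult[symmetric] abs_triangle_ineq)
  also have "\<dots> \<le> \<bar>sin (real n * x)\<bar> * 1 + 1 * \<bar>sin x\<bar>"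
    by (intro add_mono mult_left_mono mult_right_mono) auto
  finally show ?case using Suc by (simp add: algebra_simps)
qed simp

text \<open>Half-angle form of the sine bound. Integrated against \<open>p\<close>, it transfers a
  gap at n z back to z at the price of a factor n^2.\<close>

lemma one_minus_cos_of_nat_mult_le: "1 - cos (real n * x) \<le> (real n)\<^sup>2 * (1 - cos x)"
proof -
  have half: "1 - cos y = 2 * (sin (y / 2))\<^sup>2" for y :: real
    using cos_double_sin[of "y / 2"] by simp
  have "(sin (real n * (x / 2)))\<^sup>2 \<le> (real n * \<bar>sin (x / 2)\<bar>)\<^sup>2"
    using abs_sin_of_nat_mult_le[of n "x / 2"] by (intro abs_le_square_iff[THEN iffD1]) simp
  then show ?thesis unfolding half by (simp add: power_mult_distrib)
qed

text \<open>The support of \<open>p\<close> is a countable union of bounded superlevel sets, and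
  these cannot all be null. Inner regularity then yields a compact piece, which is needed because a
  compact set has positive distance to any disjoint closed set.\<close>

lemma compact_superlevel_subset:
  fixes p :: "'a::euclidean_space \<Rightarrow> real"
  assumes [measurable]: "p \<in> borel_measurable borel" and nn: "\<And>w. 0 \<le> p w"
    and pos: "(\<integral>w. p w \<partial>lborel) \<noteq> 0"
  obtains c T where "0 < c" "compact T" "\<And>w. w \<in> T \<Longrightarrow> c \<le> p w" "0 < measure lborel T"
proof -
  define A where "A n = {w. 1 / real (Suc n) \<le> p w} \<inter> cball 0 (real n)" for n
  have [measurable]: "A n \<in> sets borel" for n unfolding A_def by measurable
  have cover: "{w. p w \<noteq> 0} \<subseteq> (\<Union>n. A n)"
  proof
    fix w assume "w \<in> {w. p w \<noteq> 0}"
    then have "0 < p w" using nn[of w] by (simp add: order_less_le)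
    then obtain k where k: "1 / real (Suc k) < p w" using nat_approx_posE by blast
    obtain l where l: "norm w \<le> real l" using real_arch_simple by blast
    have "1 / real (Suc (max k l)) \<le> 1 / real (Suc k)" by (intro divide_left_mono) auto
    then have "w \<in> A (max k l)" using k l by (auto simp: A_def)
    then show "w \<in> (\<Union>n. A n)" by blast
  qed
  have "\<exists>n. A n \<notin> null_sets lborel"
  proof (rule ccontr)
    assume "\<not> ?thesis"
    then have "(\<Union>n. A n) \<in> null_sets lborel" by (intro null_sets_UN) auto
    then have "AE w in lborel. p w = 0" using cover by (auto intro: AE_I')
    then have "(\<integral>w. p w \<partial>lborel) = (\<integral>w. 0 \<partial>(lborel :: 'a measure))" by (intro integral_cong_AE) auto
    with pos show False by simp
  qed
  then obtain n where n: "A n \<notin> null_sets lborel" by blast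
  have fin: "emeasure lborel (A n) < \<infinity>"
    by (rule order_le_less_trans[OF emeasure_mono emeasure_lborel_cball_finite[of 0 "real n"]]) (auto simp: A_def)
  define a where "a = measure lborel (A n)"
  have a: "emeasure lborel (A n) = ennreal a" unfolding a_def using fin
    by (intro emeasure_eq_ennreal_measure) auto
  have a0: "0 < a"
  proof (rule ccontr)
    assume "\<not> 0 < a"
    then have "emeasure lborel (A n) = 0" unfolding a by (simp add: ennreal_neg)
    with n show False by (simp add: null_sets_def)
  qed
  \<comment> \<open>The permitted loss is the full measure \<open>a\<close>; since the inequality is
    strict, \<open>T\<close> keeps positive measure.\<close>
  obtain T where T: "closed T" "T \<subseteq> A n" "emeasure lebesgue (A n - T) < ennreal a"
    by (rule sets_lebesgue_inner_closed[of "A n" a]) (use a0 in auto)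
  have [measurable]: "T \<in> sets borel" using T by auto
  have "compact T"
    using T bounded_subset[of "cball 0 (real n)" T] by (auto simp: compact_eq_bounded_closed A_def)
  moreover have "0 < measure lborel T"
  proof -
    have "ennreal a = emeasure lborel T + emeasure lborel (A n - T)"
      unfolding a[symmetric] using T by (subst plus_emeasure) (auto intro!: arg_cong[where f="emeasure lborel"])
    moreover have "emeasure lborel (A n - T) < ennreal a" using T by simp
    ultimately have "emeasure lborel T \<noteq> 0" by auto
    moreover have "emeasure lborel T < \<infinity>" using emeasure_compact_finite[OF \<open>compact T\<close>] .
    ultimately show ?thesis by (simp add: measure_def enn2real_positive_iff zero_less_iff_neq_zero)
  qed
  ultimately show ?thesis
    using T by (intro that[of "1 / real (Suc n)" T]) (auto simp: A_def)
qed

text \<open>Continuity of translation at 0. An open neighbourhood U of \<open>T\<close> exceeds it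
  by less than half its measure; a shift shorter than the distance from \<open>T\<close> to the
  complement of U stays inside U, so at most half of the translate can leave
  \<open>T\<close>.\<close>

lemma measure_compact_Int_translate_ge:
  fixes T :: "'a::euclidean_space set"
  assumes T: "compact T" and pos: "0 < measure lborel T"
  obtains d where "0 < d" "\<And>h. norm h < d \<Longrightarrow> measure lborel T / 2 \<le> measure lborel (T \<inter> (+) h ` T)"
proof -
  let ?m = "measure lborel T"
  have [measurable]: "T \<in> sets borel" using T by (simp add: compact_imp_closed borel_closed)
  obtain U where U: "open U" "T \<subseteq> U" "emeasure lebesgue (U - T) < ennreal (?m / 2)"
    by (rule sets_lebesgue_outer_open[of T "?m / 2"]) (use pos in auto)
  have [measurable]: "U \<in> sets borel" using U by auto
  have "T \<inter> (- U) = {}" using U by auto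
  then obtain d where d: "0 < d" "\<And>x y. x \<in> T \<Longrightarrow> y \<in> - U \<Longrightarrow> d \<le> dist x y"
    using separate_compact_closed[OF T, of "- U"] U by blast
  have UT: "emeasure lborel (U - T) < ennreal (?m / 2)" using U by simp
  show ?thesis
  proof (rule that[OF d(1)])
    fix h :: 'a assume h: "norm h < d"
    let ?T = "(+) h ` T"
    have cT: "compact ?T" using T by (rule compact_translation)
    have [measurable]: "?T \<in> sets borel" using cT by (simp add: compact_imp_closed borel_closed)
    have sub: "?T \<subseteq> U"
    proof
      fix y assume "y \<in> ?T"
      then obtain x where x: "x \<in> T" "y = h + x" by blast
      show "y \<in> U" using d(2)[OF x(1), of y] h x by (force simp: dist_norm)
    qed
    have mT: "measure lborel ?T = ?m"
      using measure_translation[of h T] by (simp add: measure_completion)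
    have "?m = measure lborel (T \<inter> ?T) + measure lborel (?T - T)"
    proof -
      have f0: "emeasure lborel ?T < top" using emeasure_compact_finite[OF cT] by simp
      have "measure lborel ?T = measure lborel ((T \<inter> ?T) \<union> (?T - T))"
        by (rule arg_cong[where f="measure lborel"]) blast
      also have "\<dots> = measure lborel (T \<inter> ?T) + measure lborel (?T - T)"
        by (intro measure_Union) (auto simp: top.not_eq_extremum intro!: order_le_less_trans[OF emeasure_mono f0])
      finally show ?thesis by (simp only: mT)
    qed
    moreover have "measure lborel (?T - T) \<le> ?m / 2"
    proof -
      have "emeasure lborel (?T - T) \<le> emeasure lborel (U - T)" using sub by (intro emeasure_mono) auto
      also have "\<dots> \<le> ennreal (?m / 2)" using UT by simp
      finally show ?thesis unfolding measure_def using pos by (intro enn2real_leI) auto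
    qed
    ultimately show "?m / 2 \<le> measure lborel (T \<inter> ?T)" by simp
  qed
qed

text \<open>A quantitative substitute for the Riemann-Lebesgue lemma handles large z: on a compact
  set where \<open>p\<close> is bounded below, a short translation pairs each frequency with one of
  opposite cosine. Every other nonzero z is moved into that region by an integer factor.\<close>

lemma spectral_gap:
  fixes p :: "'a::euclidean_space \<Rightarrow> real"
  assumes pm[measurable]: "p \<in> borel_measurable borel" and nn: "\<And>w. 0 \<le> p w"
    and pint: "integrable lborel p" and pos: "(\<integral>w. p w \<partial>lborel) \<noteq> 0"
  obtains c where "0 < c" "\<And>z. c * min 1 ((norm z)\<^sup>2) \<le> (\<integral>w. p w * (1 - cos (w \<bullet> z)) \<partial>lborel)"
proof -
  let ?\<mu> = "\<lambda>z. \<integral>w. p w * (1 - cos (w \<bullet> z)) \<partial>lborel"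
  have int: "integrable lborel (\<lambda>w. p w * (1 - cos (w \<bullet> z)))" for z
  proof (rule Bochner_Integration.integrable_bound[of _ "\<lambda>w. p w * 2"])
    show "integrable lborel (\<lambda>w. p w * 2)" using pint by simp
    have "\<bar>1 - cos x\<bar> \<le> 2" for x :: real using cos_ge_minus_one[of x] cos_le_one[of x] by linarith
    then show "AE w in lborel. norm (p w * (1 - cos (w \<bullet> z))) \<le> norm (p w * 2)"
      using nn by (intro AE_I2) (simp add: abs_mult mult_left_mono)
  qed measurable
  obtain c T where T: "0 < c" "compact T" "\<And>w. w \<in> T \<Longrightarrow> c \<le> p w" "0 < measure lborel T"
    using compact_superlevel_subset[OF pm nn pos] by blast
  have [measurable]: "T \<in> sets borel" using T by (simp add: compact_imp_closed borel_closed)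
  let ?m = "measure lborel T"
  obtain d where d: "0 < d" "\<And>h. norm h < d \<Longrightarrow> ?m / 2 \<le> measure lborel (T \<inter> (+) h ` T)"
    using measure_compact_Int_translate_ge[OF T(2,4)] by blast
  \<comment> \<open>The shift that flips the cosine has length pi / |z|; beyond this radius it is
    shorter than \<open>d\<close>.\<close>
  define R where "R = pi / d + 1"
  have R: "0 < R" using d by (simp add: R_def add_pos_pos)
  have finT: "emeasure lborel T < \<infinity>" using emeasure_compact_finite[OF T(2)] .
  have far: "c * ?m / 2 \<le> ?\<mu> z" if z: "R \<le> norm z" for z
  proof -
    let ?f = "\<lambda>w. 1 - cos (w \<bullet> z)"
    have z0: "z \<noteq> 0" using z R by auto
    define h where "h = (pi / (norm z)\<^sup>2) *\<^sub>R z"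
    have "norm h = pi / norm z" using z0 by (simp add: h_def power2_eq_square)
    also have "\<dots> < d"
    proof -
      have "pi / d < norm z" using z unfolding R_def by simp
      then show ?thesis using d z0 by (simp add: field_simps)
    qed
    finally have hd: "?m / 2 \<le> measure lborel (T \<inter> (+) h ` T)" by (rule d(2))
    \<comment> \<open>Translation by \<open>h\<close> flips the sign of \<open>cos (w \<bullet> z)\<close>, so \<open>w\<close> and \<open>w - h\<close>
      together contribute exactly 2 whenever both lie in \<open>T\<close>.\<close>
    have "h \<bullet> z = pi" using z0 by (simp add: h_def dot_square_norm)
    then have shift: "?f w + ?f (- h + w) = 2" for w
      by (simp add: inner_diff_left inner_add_left cos_diff)
    define g where "g w = indicator T w * ?f w" for w
    have [measurable]: "g \<in> borel_measurable borel" unfolding g_def by measurable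
    have g0: "0 \<le> g w" for w by (simp add: g_def)
    have gi: "integrable lborel g"
    proof (rule Bochner_Integration.integrable_bound[of _ "\<lambda>w. indicator T w * 2"])
      show "integrable lborel (\<lambda>w. indicator T w * 2 :: real)" using finT by simp
      have "\<bar>1 - cos x\<bar> \<le> 2" for x :: real using cos_ge_minus_one[of x] cos_le_one[of x] by linarith
      then show "AE w in lborel. norm (g w) \<le> norm (indicator T w * 2 :: real)"
        by (intro AE_I2) (simp add: g_def indicator_def)
    qed measurable
    have gi': "integrable lborel (\<lambda>w. g (- h + w))" and ge: "(\<integral>w. g (- h + w) \<partial>lborel) = (\<integral>w. g w \<partial>lborel)"
    proof -
      have "integrable (distr lborel borel ((+) (- h))) g" using gi by (simp only: lborel_distr_plus)
      then show "integrable lborel (\<lambda>w. g (- h + w))" by (subst (asm) integrable_distr_eq) auto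
      have "(\<integral>w. g w \<partial>lborel) = (\<integral>w. g w \<partial>(distr lborel borel ((+) (- h))))" by (simp only: lborel_distr_plus)
      also have "\<dots> = (\<integral>w. g (- h + w) \<partial>lborel)" by (rule integral_distr) auto
      finally show "(\<integral>w. g (- h + w) \<partial>lborel) = (\<integral>w. g w \<partial>lborel)" ..
    qed
    let ?I = "T \<inter> (+) h ` T"
    have cI: "compact ((+) h ` T)" using T(2) by (rule compact_translation)
    have [measurable]: "(+) h ` T \<in> sets borel" using cI by (simp add: compact_imp_closed borel_closed)
    have finI: "emeasure lborel ?I < \<infinity>"
      by (rule order_le_less_trans[OF emeasure_mono finT]) auto
    have "?m \<le> 2 * measure lborel ?I" using hd by simp
    also have "\<dots> = (\<integral>w. 2 * indicator ?I w \<partial>lborel)" by simp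
    also have "\<dots> \<le> (\<integral>w. g w + g (- h + w) \<partial>lborel)"
    proof (rule integral_mono)
      show "integrable lborel (\<lambda>w. 2 * indicator ?I w :: real)" using finI by simp
      show "integrable lborel (\<lambda>w. g w + g (- h + w))" using gi gi' by simp
      fix w
      show "2 * indicator ?I w \<le> g w + g (- h + w)"
      proof (cases "w \<in> ?I")
        case True
        then have "w \<in> T" "- h + w \<in> T" by auto
        then have "g w + g (- h + w) = ?f w + ?f (- h + w)" unfolding g_def by (simp only: indicator_simps mult_1)
        with True show ?thesis unfolding shift by simp
      next
        case False
        then show ?thesis using g0[of w] g0[of "- h + w"] by simp
      qed
    qed
    also have "\<dots> = 2 * (\<integral>w. g w \<partial>lborel)"
      using gi gi' ge by simp
    finally have "c * ?m / 2 \<le> c * (\<integral>w. g w \<partial>lborel)" using T(1) by simp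
    also have "\<dots> = (\<integral>w. c * g w \<partial>lborel)" by simp
    also have "\<dots> \<le> ?\<mu> z"
    proof (rule integral_mono[OF _ int])
      show "integrable lborel (\<lambda>w. c * g w)" using gi by simp
      fix w show "c * g w \<le> p w * ?f w"
        using T(3)[of w] nn[of w] by (auto simp: g_def indicator_def intro!: mult_right_mono)
    qed
    finally show ?thesis .
  qed
  \<comment> \<open>With n the integer factor used below, n times min 1 |z| is at most
    \<open>R + 2\<close>; its square is the loss in returning from n z to z.\<close>
  define c' where "c' = c * ?m / 2 / (R + 2)\<^sup>2"
  have c': "0 < c'" using T R by (simp add: c'_def)
  show ?thesis
  proof (rule that[OF c'])
    fix z :: 'a
    show "c' * min 1 ((norm z)\<^sup>2) \<le> ?\<mu> z"
    proof (cases "z = 0")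
      case False
      \<comment> \<open>The least integer that pushes n z into the region |z| \<ge>
        \<open>R\<close>, where \<open>far\<close> applies.\<close>
      define n where "n = nat \<lceil>R / norm z\<rceil>"
      have n1: "R / norm z \<le> real n" unfolding n_def by (rule real_nat_ceiling_ge)
      have n2: "real n \<le> R / norm z + 1" unfolding n_def using R by (simp add: of_nat_nat)
      have "c * ?m / 2 \<le> ?\<mu> (real n *\<^sub>R z)"
        using n1 False by (intro far) (simp add: field_simps)
      also have "\<dots> \<le> (\<integral>w. (real n)\<^sup>2 * (p w * (1 - cos (w \<bullet> z))) \<partial>lborel)"
      proof (rule integral_mono[OF int])
        show "integrable lborel (\<lambda>w. (real n)\<^sup>2 * (p w * (1 - cos (w \<bullet> z))))" using int by simp
        fix w show "p w * (1 - cos (w \<bullet> real n *\<^sub>R z)) \<le> (real n)\<^sup>2 * (p w * (1 - cos (w \<bullet> z)))"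
          using mult_left_mono[OF one_minus_cos_of_nat_mult_le[of n "w \<bullet> z"] nn[of w]]
          by (simp add: mult_ac)
      qed
      also have "\<dots> = (real n)\<^sup>2 * ?\<mu> z" by simp
      finally have n: "c * ?m / 2 \<le> (real n)\<^sup>2 * ?\<mu> z" .
      have \<mu>0: "0 \<le> ?\<mu> z" by (intro integral_nonneg_AE AE_I2 mult_nonneg_nonneg nn) simp
      define q where "q = min 1 (norm z)"
      have q: "0 < q" "q \<le> 1" "q \<le> norm z" using False by (auto simp: q_def)
      have "real n * q \<le> (R / norm z + 1) * q" using n2 q by (intro mult_right_mono) auto
      also have "\<dots> = R * (q / norm z) + q" by (simp add: algebra_simps)
      also have "\<dots> \<le> R * 1 + 1" using q R False by (intro add_mono mult_left_mono) (auto simp: field_simps)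
      finally have nq: "real n * q \<le> R + 2" by simp
      have "c * ?m / 2 * q\<^sup>2 \<le> (real n)\<^sup>2 * ?\<mu> z * q\<^sup>2" using n by (intro mult_right_mono) auto
      also have "\<dots> = (real n * q)\<^sup>2 * ?\<mu> z" by (simp add: power_mult_distrib)
      also have "\<dots> \<le> (R + 2)\<^sup>2 * ?\<mu> z" using nq q \<mu>0 by (intro mult_right_mono power_mono) auto
      finally have "c' * q\<^sup>2 \<le> ?\<mu> z" unfolding c'_def using R by (simp add: field_simps)
      moreover have "q\<^sup>2 = min 1 ((norm z)\<^sup>2)"
        using power_mono[of "norm z" 1 2] power_mono[of 1 "norm z" 2] unfolding q_def min_def by auto
      ultimately show ?thesis by simp
    qed simp
  qed
qed

section \<open>Exponential moments from analyticity\<close>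

text \<open>L'Hopital is applied only once, because \<open>f'\<close> is assumed differentiable at
  \<open>t\<close> alone; what remains is settled by the definition of that derivative.\<close>

lemma symmetric_second_difference_tendsto:
  fixes f f' :: "real \<Rightarrow> real"
  assumes f: "\<And>x. \<bar>x\<bar> < r \<Longrightarrow> (f has_real_derivative f' x) (at x)"
    and f': "(f' has_real_derivative D) (at t)" and t: "\<bar>t\<bar> < r"
  shows "((\<lambda>h. (f (t + h) + f (t - h) - 2 * f t) / h\<^sup>2) \<longlongrightarrow> D) (at 0)"
proof (rule lhopital)
  have cont: "isCont f t" using f[OF t] by (rule DERIV_isCont)
  have "((\<lambda>h. f (t + h) + f (t - h) - 2 * f t) \<longlongrightarrow> f (t + 0) + f (t - 0) - 2 * f t) (at 0)"
    using cont by (intro tendsto_intros isCont_tendsto_compose[of _ f]) auto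
  then show "((\<lambda>h. f (t + h) + f (t - h) - 2 * f t) \<longlongrightarrow> 0) (at 0)" by simp
  have "((\<lambda>h::real. h\<^sup>2) \<longlongrightarrow> 0\<^sup>2) (at 0)" by (intro tendsto_intros)
  then show "((\<lambda>h::real. h\<^sup>2) \<longlongrightarrow> 0) (at 0)" by simp
  show "\<forall>\<^sub>F h::real in at 0. h\<^sup>2 \<noteq> 0" "\<forall>\<^sub>F h::real in at 0. 2 * h \<noteq> 0"
    by (auto simp: eventually_at_filter)
  have "\<forall>\<^sub>F h in at 0. \<bar>h\<bar> < r - \<bar>t\<bar>"
    using t by (auto simp: eventually_at dist_real_def intro!: exI[of _ "r - \<bar>t\<bar>"])
  then show "\<forall>\<^sub>F h in at 0. ((\<lambda>h. f (t + h) + f (t - h) - 2 * f t) has_real_derivative f' (t + h) - f' (t - h)) (at h)"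
  proof eventually_elim
    case (elim h)
    have "(f has_real_derivative f' (t + h)) (at (t + h))" "(f has_real_derivative f' (t - h)) (at (t - h))"
      using elim by (auto intro!: f)
    then show ?case
      by (auto intro!: derivative_eq_intros DERIV_chain2[of f])
  qed
  show "\<forall>\<^sub>F h in at 0. ((\<lambda>h::real. h\<^sup>2) has_real_derivative 2 * h) (at h)"
    by (auto intro!: always_eventually derivative_eq_intros)
  have 1: "((\<lambda>h. (f' (t + h) - f' t) / h) \<longlongrightarrow> D) (at 0)"
    using f' by (simp add: DERIV_def)
  \<comment> \<open>The symmetric quotient is the average of the forward and the backward quotient
    of \<open>f'\<close>, so the limit is also needed along -h.\<close>
  have "filterlim (\<lambda>h. - h) (at 0) (at (0::real))"
    by (auto simp: filterlim_at eventually_at_filter intro!: tendsto_eq_intros)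
  from filterlim_compose[OF 1 this]
  have "((\<lambda>h. (f' (t + (- h)) - f' t) / (- h)) \<longlongrightarrow> D) (at 0)" .
  from tendsto_divide[OF tendsto_add[OF 1 this] tendsto_const[of 2]]
  have "((\<lambda>h. ((f' (t + h) - f' t) / h + (f' (t + (- h)) - f' t) / (- h)) / 2) \<longlongrightarrow> D) (at 0)"
    by simp
  then show "((\<lambda>h. (f' (t + h) - f' (t - h)) / (2 * h)) \<longlongrightarrow> D) (at 0)"
    by (rule Lim_transform_eventually) (auto simp: eventually_at_filter field_simps)
qed

text \<open>A converse to differentiation under the integral: smoothness of the transform forces the
  moment to exist. The weight \<open>W\<close> permits iteration, since the conclusion is again a
  cosine transform, now with weight \<open>W w * (X w)\<^sup>2\<close>.\<close>

lemma second_moment_of_cos_transform: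
  fixes X W :: "'a \<Rightarrow> real" and f f' f'' :: "real \<Rightarrow> real"
  assumes [measurable]: "X \<in> borel_measurable M"
    and W: "integrable M W" "\<And>w. 0 \<le> W w"
    and f: "\<And>t. \<bar>t\<bar> < r \<Longrightarrow> (\<integral>w. W w * cos (t * X w) \<partial>M) = f t"
    and f': "\<And>x. \<bar>x\<bar> < r \<Longrightarrow> (f has_real_derivative f' x) (at x)"
    and f'': "\<And>x. \<bar>x\<bar> < r \<Longrightarrow> (f' has_real_derivative f'' x) (at x)"
    and r: "0 < r"
  shows "integrable M (\<lambda>w. W w * (X w)\<^sup>2)"
    and "\<And>t. \<bar>t\<bar> < r \<Longrightarrow> (\<integral>w. W w * (X w)\<^sup>2 * cos (t * X w) \<partial>M) = - f'' t"
proof -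
  have [measurable]: "W \<in> borel_measurable M" using W by auto
  define h where "h n = 1 / real (Suc n)" for n
  have h0: "h \<longlonglongrightarrow> 0" unfolding h_def by (rule LIMSEQ_Suc[OF lim_1_over_n])
  have hpos: "h n \<noteq> 0" for n by (simp add: h_def)
  have h_at: "filterlim h (at 0) sequentially"
    using h0 hpos by (auto simp: filterlim_at)
  \<comment> \<open>The negated second difference quotient of \<open>t \<mapsto> cos (t * x)\<close> at step \<open>h n\<close> is
    \<open>q n x * cos (t * x)\<close>: Fatou at \<open>t = 0\<close> gives integrability, then dominated convergence applies.\<close>
  define q where "q n x = 2 * (1 - cos (h n * x)) / (h n)\<^sup>2" for n x
  \<comment> \<open>This form gives all three properties used below: nonnegativity for Fatou, the
    bound x^2 for domination, and the limit x^2.\<close>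
  have q_sin: "q n x = (sin (h n * x / 2) / (h n / 2))\<^sup>2" for n x
    using cos_double_sin[of "h n * x / 2"] by (simp add: q_def power_divide)
  have q0: "0 \<le> q n x" for n x unfolding q_sin by simp
  have qle: "q n x \<le> x\<^sup>2" for n x
  proof -
    have "\<bar>sin (h n * x / 2) / (h n / 2)\<bar> \<le> \<bar>x\<bar>"
      using abs_sin_x_le_abs_x[of "h n * x / 2"] hpos[of n] by (simp add: abs_mult field_simps)
    then show ?thesis unfolding q_sin by (rule abs_le_square_iff[THEN iffD1])
  qed
  have qlim: "(\<lambda>n. q n x) \<longlonglongrightarrow> x\<^sup>2" for x
  proof -
    have "((\<lambda>y. sin (y * x / 2)) has_real_derivative x / 2) (at 0)"
      by (auto intro!: derivative_eq_intros)
    then have "((\<lambda>y. sin (y * x / 2) / y) \<longlongrightarrow> x / 2) (at 0)" by (simp add: DERIV_def)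
    from filterlim_compose[OF this h_at] have "(\<lambda>n. sin (h n * x / 2) / h n) \<longlonglongrightarrow> x / 2" .
    from tendsto_power[OF tendsto_mult[OF tendsto_const[of 2] this], of 2]
    have "(\<lambda>n. (2 * (sin (h n * x / 2) / h n))\<^sup>2) \<longlonglongrightarrow> x\<^sup>2" by (simp add: power_divide)
    then show ?thesis unfolding q_sin by (simp add: mult.commute)
  qed
  have [measurable]: "(\<lambda>w. q n (X w)) \<in> borel_measurable M" for n
    unfolding q_def by measurable
  have Wi: "integrable M (\<lambda>w. W w * cos (g w))" if [measurable]: "g \<in> borel_measurable M" for g
    by (rule Bochner_Integration.integrable_bound[OF W(1)])
       (use W in \<open>auto simp: abs_mult mult_le_cancel_left1 intro!: mult_left_le\<close>)
  have Wq: "integrable M (\<lambda>w. W w * q n (X w) * cos (t * X w))"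
    and Wq': "(\<integral>w. W w * q n (X w) * cos (t * X w) \<partial>M)
       = - ((f (t + h n) + f (t - h n) - 2 * f t) / (h n)\<^sup>2)"
    if t: "\<bar>t\<bar> < r" "\<bar>t + h n\<bar> < r" "\<bar>t - h n\<bar> < r" for n t
  proof -
    have eq: "W w * q n (X w) * cos (t * X w) =
       - ((W w * cos ((t + h n) * X w) + W w * cos ((t - h n) * X w) - 2 * (W w * cos (t * X w))) / (h n)\<^sup>2)" for w
      using hpos[of n] by (simp add: q_def cos_add cos_diff field_simps distrib_right left_diff_distrib)
    show "integrable M (\<lambda>w. W w * q n (X w) * cos (t * X w))"
      unfolding eq by (intro Bochner_Integration.integrable_minus Bochner_Integration.integrable_divide Bochner_Integration.integrable_diff Bochner_Integration.integrable_add integrable_mult_right Wi) auto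
    show "(\<integral>w. W w * q n (X w) * cos (t * X w) \<partial>M)
       = - ((f (t + h n) + f (t - h n) - 2 * f t) / (h n)\<^sup>2)"
      unfolding eq using t by (simp add: Wi f[symmetric])
  qed
  have ev: "\<forall>\<^sub>F n in sequentially. \<bar>t + h n\<bar> < r \<and> \<bar>t - h n\<bar> < r" if t: "\<bar>t\<bar> < r" for t
  proof -
    have "\<forall>\<^sub>F n in sequentially. \<bar>h n\<bar> < r - \<bar>t\<bar>"
      using tendstoD[OF h0, of "r - \<bar>t\<bar>"] t by (simp add: dist_real_def)
    then show ?thesis by eventually_elim auto
  qed
  have lim: "(\<lambda>n. \<integral>w. W w * q n (X w) * cos (t * X w) \<partial>M) \<longlonglongrightarrow> - f'' t" if t: "\<bar>t\<bar> < r" for t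
  proof (rule Lim_transform_eventually)
    show "(\<lambda>n. - ((f (t + h n) + f (t - h n) - 2 * f t) / (h n)\<^sup>2)) \<longlonglongrightarrow> - f'' t"
      by (intro tendsto_minus filterlim_compose[OF symmetric_second_difference_tendsto h_at])
         (use f' f''[OF t] t in auto)
    show "\<forall>\<^sub>F n in sequentially. - ((f (t + h n) + f (t - h n) - 2 * f t) / (h n)\<^sup>2) = (\<integral>w. W w * q n (X w) * cos (t * X w) \<partial>M)"
      using ev[OF t] by eventually_elim (use Wq' t in auto)
  qed
  show int: "integrable M (\<lambda>w. W w * (X w)\<^sup>2)"
  proof -
    have "(\<integral>\<^sup>+w. ennreal (W w * (X w)\<^sup>2) \<partial>M) = (\<integral>\<^sup>+w. liminf (\<lambda>n. ennreal (W w * q n (X w))) \<partial>M)"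
    proof (intro nn_integral_cong)
      fix w
      have "(\<lambda>n. ennreal (W w * q n (X w))) \<longlonglongrightarrow> ennreal (W w * (X w)\<^sup>2)"
        by (intro tendsto_intros qlim)
      then show "ennreal (W w * (X w)\<^sup>2) = liminf (\<lambda>n. ennreal (W w * q n (X w)))"
        by (simp add: lim_imp_Liminf)
    qed
    also have "\<dots> \<le> liminf (\<lambda>n. \<integral>\<^sup>+w. ennreal (W w * q n (X w)) \<partial>M)"
      by (intro nn_integral_liminf) measurable
    also have "\<dots> = ennreal (- f'' 0)"
    proof (rule lim_imp_Liminf)
      show "(\<lambda>n. \<integral>\<^sup>+w. ennreal (W w * q n (X w)) \<partial>M) \<longlonglongrightarrow> ennreal (- f'' 0)"
      proof (rule Lim_transform_eventually)
        show "(\<lambda>n. ennreal (\<integral>w. W w * q n (X w) * cos (0 * X w) \<partial>M)) \<longlonglongrightarrow> ennreal (- f'' 0)"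
          by (intro tendsto_ennrealI lim) (use r in auto)
        show "\<forall>\<^sub>F n in sequentially. ennreal (\<integral>w. W w * q n (X w) * cos (0 * X w) \<partial>M) = (\<integral>\<^sup>+w. ennreal (W w * q n (X w)) \<partial>M)"
          using ev[of 0, simplified, OF r]
        proof eventually_elim
          case (elim n)
          then have "integrable M (\<lambda>w. W w * q n (X w))" using Wq[of 0 n] r by simp
          then show ?case using W q0 by (simp add: nn_integral_eq_integral)
        qed
      qed
    qed simp
    finally have "(\<integral>\<^sup>+w. ennreal (W w * (X w)\<^sup>2) \<partial>M) < \<infinity>" by (simp add: top.not_eq_extremum order_le_less_trans)
    then show ?thesis using W by (intro integrableI_nonneg) auto
  qed
  fix t assume t: "\<bar>t\<bar> < r"
  have "(\<lambda>n. \<integral>w. W w * q n (X w) * cos (t * X w) \<partial>M) \<longlonglongrightarrow> (\<integral>w. W w * (X w)\<^sup>2 * cos (t * X w) \<partial>M)"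
  proof (rule integral_dominated_convergence[where w="\<lambda>w. W w * (X w)\<^sup>2"])
    show "AE w in M. norm (W w * q n (X w) * cos (t * X w)) \<le> W w * (X w)\<^sup>2" for n
    proof (rule AE_I2)
      fix w
      have "W w * q n (X w) * \<bar>cos (t * X w)\<bar> \<le> W w * (X w)\<^sup>2 * 1"
        using W q0 qle by (intro mult_mono) auto
      then show "norm (W w * q n (X w) * cos (t * X w)) \<le> W w * (X w)\<^sup>2"
        using W q0 by (simp add: abs_mult)
    qed
    show "AE w in M. (\<lambda>n. W w * q n (X w) * cos (t * X w)) \<longlonglongrightarrow> W w * (X w)\<^sup>2 * cos (t * X w)"
      by (intro AE_I2 tendsto_intros qlim)
  qed (use int in auto)
  from LIMSEQ_unique[OF this lim[OF t]]
  show "(\<integral>w. W w * (X w)\<^sup>2 * cos (t * X w) \<partial>M) = - f'' t" .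
qed

lemma funpow_diffs_at_0: "(diffs ^^ n) c 0 = fact n * (c n :: real)"
proof -
  \<comment> \<open>Each \<open>diffs\<close> raises the index by one, so the induction must range
    over all positions k.\<close>
  have "fact k * (diffs ^^ n) c k = fact (n + k) * c (n + k)" for k
  proof (induction n arbitrary: k)
    case (Suc n)
    have "fact k * (diffs ^^ Suc n) c k = fact (Suc k) * (diffs ^^ n) c (Suc k)"
      by (simp add: diffs_def)
    also have "\<dots> = fact (Suc n + k) * c (Suc n + k)" unfolding Suc.IH by simp
    finally show ?case .
  qed simp
  from this[of 0] show ?thesis by simp
qed

text \<open>Induction with weight X^(2n): termwise derivatives of the series converge on the whole
  interval, so each step supplies the two derivatives needed for the next. Even powers keep the
  weight nonnegative; the alternating sign disappears in the absolute value because the moment is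
  nonnegative.\<close>

lemma power_series_cos_transform_moments:
  fixes X :: "'a \<Rightarrow> real" and c :: "nat \<Rightarrow> real"
  assumes M: "finite_measure M" and X[measurable]: "X \<in> borel_measurable M"
    and c: "\<And>t. \<bar>t\<bar> < r \<Longrightarrow> (\<lambda>n. c n * t ^ n) sums (\<integral>w. cos (t * X w) \<partial>M)"
    and r: "0 < r"
  shows "integrable M (\<lambda>w. X w ^ (2 * n))"
    and "(\<integral>w. X w ^ (2 * n) \<partial>M) = fact (2 * n) * \<bar>c (2 * n)\<bar>"
proof -
  interpret finite_measure M by fact
  let ?c = "\<lambda>n. (diffs ^^ n) c"
  let ?f = "\<lambda>n t. \<Sum>k. ?c n k * t ^ k"
  have sm: "summable (\<lambda>k. ?c n k * t ^ k)" if "\<bar>t\<bar> < r" for n t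
    using that
  proof (induction n arbitrary: t)
    case 0 then show ?case using c by (auto simp: sums_iff)
  next
    case (Suc n) then show ?case using termdiff_converges[of t r "?c n"] by simp
  qed
  have der: "(?f n has_real_derivative ?f (Suc n) t) (at t)" if t: "\<bar>t\<bar> < r" for n t
  proof -
    obtain u where u: "\<bar>t\<bar> < u" "u < r" using dense t by blast
    then show ?thesis using termdiffs_strong[of "?c n" u t] sm[of u n] by simp
  qed
  have main: "integrable M (\<lambda>w. X w ^ (2 * n)) \<and>
     (\<forall>t. \<bar>t\<bar> < r \<longrightarrow> (\<integral>w. X w ^ (2 * n) * cos (t * X w) \<partial>M) = (-1) ^ n * ?f (2 * n) t)" for n
  proof (induction n)
    case 0 then show ?case using c by (simp add: sums_iff)
  next
    case (Suc n)
    let ?g = "\<lambda>k t. (-1) ^ n * ?f k t"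
    have g: "(?g k has_real_derivative ?g (Suc k) t) (at t)" if "\<bar>t\<bar> < r" for k t
      by (intro DERIV_cmult der that)
    have W: "0 \<le> X w ^ (2 * n)" for w by (simp add: power_mult)
    have eq: "X w ^ (2 * Suc n) = X w ^ (2 * n) * (X w)\<^sup>2" for w
      by (simp add: power_add[symmetric])
    note sec = second_moment_of_cos_transform[of X M "\<lambda>w. X w ^ (2 * n)" r "?g (2 * n)" "?g (Suc (2 * n))" "?g (Suc (Suc (2 * n)))"]
    have "integrable M (\<lambda>w. X w ^ (2 * n) * (X w)\<^sup>2)"
      using Suc W r by (intro sec(1) g) auto
    moreover have "(\<integral>w. X w ^ (2 * n) * (X w)\<^sup>2 * cos (t * X w) \<partial>M) = - ?g (Suc (Suc (2 * n))) t" if "\<bar>t\<bar> < r" for t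
      using Suc W r that by (intro sec(2) g) auto
    ultimately show ?case unfolding eq by simp
  qed
  from main show "integrable M (\<lambda>w. X w ^ (2 * n))" by blast
  have "(\<integral>w. X w ^ (2 * n) \<partial>M) = (-1) ^ n * ?f (2 * n) 0"
    using main[of n] r by (auto dest!: spec[of _ 0])
  also have "?f (2 * n) 0 = fact (2 * n) * c (2 * n)"
    by (simp only: powser_zero funpow_diffs_at_0)
  finally have e: "(\<integral>w. X w ^ (2 * n) \<partial>M) = (-1) ^ n * (fact (2 * n) * c (2 * n))" .
  have "0 \<le> (\<integral>w. X w ^ (2 * n) \<partial>M)" by (intro integral_nonneg_AE) (simp add: power_mult)
  then have "(\<integral>w. X w ^ (2 * n) \<partial>M) = \<bar>(\<integral>w. X w ^ (2 * n) \<partial>M)\<bar>" by simp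
  also have "\<dots> = fact (2 * n) * \<bar>c (2 * n)\<bar>" unfolding e by (simp add: abs_mult power_abs)
  finally show "(\<integral>w. X w ^ (2 * n) \<partial>M) = fact (2 * n) * \<bar>c (2 * n)\<bar>" .
qed

text \<open>In the series of cosh (a X) the factorials cancel against those in the moments, leaving
  |c (2k)| a^(2k), which is summable inside the radius of convergence. Finally exp |x| \<le> 2 cosh
  x.\<close>

lemma power_series_cos_transform_exp_moment:
  fixes X :: "'a \<Rightarrow> real" and c :: "nat \<Rightarrow> real"
  assumes M: "finite_measure M" and X[measurable]: "X \<in> borel_measurable M"
    and c: "\<And>t. \<bar>t\<bar> < r \<Longrightarrow> (\<lambda>n. c n * t ^ n) sums (\<integral>w. cos (t * X w) \<partial>M)"
    and a: "0 < a" "a < r"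
  shows "integrable M (\<lambda>w. exp (a * \<bar>X w\<bar>))"
proof -
  interpret finite_measure M by fact
  note mom = power_series_cos_transform_moments[OF M X c order.strict_trans[OF a]]
  let ?t = "\<lambda>n w. if even n then (a * X w) ^ n /\<^sub>R fact n else 0"
  have t0: "0 \<le> ?t n w" for n w by (auto elim!: evenE simp: power_mult)
  have int: "integrable M (?t n)" and val: "(\<integral>w. ?t n w \<partial>M) \<le> \<bar>c n * a ^ n\<bar>" for n
  proof -
    have "integrable M (?t n) \<and> (\<integral>w. ?t n w \<partial>M) \<le> \<bar>c n * a ^ n\<bar>"
    proof (cases "even n")
      case True
      then obtain k where k: "n = 2 * k" by (elim evenE)
      have "?t n = (\<lambda>w. a ^ n / fact n * X w ^ n)"
        using True by (auto simp: power_mult_distrib field_simps)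
      then show ?thesis using mom[of k] a unfolding k
        by (simp add: abs_mult)
    qed simp
    then show "integrable M (?t n)" "(\<integral>w. ?t n w \<partial>M) \<le> \<bar>c n * a ^ n\<bar>" by auto
  qed
  have sum: "summable (\<lambda>n. \<bar>c n * a ^ n\<bar>)"
  proof -
    \<comment> \<open>Convergence at a larger point u gives absolute convergence at
      \<open>a\<close>.\<close>
    obtain u where u: "a < u" "u < r" using dense a by blast
    have "summable (\<lambda>n. c n * u ^ n)" using c[of u] u a by (auto simp: sums_iff)
    from powser_insidea[OF this, of a] show ?thesis using u a by simp
  qed
  have "integrable M (\<lambda>w. \<Sum>n. ?t n w)"
  proof (rule integrable_suminf[OF int])
    show "AE w in M. summable (\<lambda>n. norm (?t n w))"
      using cosh_converges[of "a * X w" for w] t0 by (auto simp: sums_iff)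
    show "summable (\<lambda>n. \<integral>w. norm (?t n w) \<partial>M)"
      by (rule summable_comparison_test'[OF sum, of 0])
         (use val t0 in \<open>auto simp: integral_nonneg_AE\<close>)
  qed
  then have "integrable M (\<lambda>w. cosh (a * X w))"
    using cosh_converges[of "a * X w" for w] by (simp add: sums_iff)
  then have int2: "integrable M (\<lambda>w. 2 * cosh (a * X w))" by simp
  have "exp (a * \<bar>X w\<bar>) \<le> 2 * cosh (a * X w)" for w
  proof -
    have "2 * cosh (a * X w) = exp (a * X w) + exp (- (a * X w))" by (simp add: cosh_def)
    then show ?thesis by (auto simp: abs_if)
  qed
  then have "AE w in M. norm (exp (a * \<bar>X w\<bar>)) \<le> norm (2 * cosh (a * X w))" by simp
  moreover have "(\<lambda>w. exp (a * \<bar>X w\<bar>)) \<in> borel_measurable M" by measurable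
  ultimately show ?thesis by (intro Bochner_Integration.integrable_bound[OF int2])
qed

section \<open>Concentration under square-root exponential moments\<close>

text \<open>Needed for arbitrarily negative x as well. There, multiply 1 + x + x^2 by the lower
  bound 1 - x + x^2/2 for exp (-x): the linear terms cancel and the cubic term has the favourable
  sign.\<close>

lemma exp_le_quadratic:
  fixes x :: real
  assumes "x \<le> 1"
  shows "exp x \<le> 1 + x + x\<^sup>2"
proof (cases "0 \<le> x")
  case True
  with assms show ?thesis by (rule exp_bound[rotated])
next
  case False
  let ?q = "1 + x + x\<^sup>2"
  have q: "0 < ?q"
  proof -
    have "?q = (x + 1/2)\<^sup>2 + 3/4" by (simp add: power2_eq_square algebra_simps)
    also have "0 < \<dots>" by (intro add_nonneg_pos) auto
    finally show ?thesis .
  qed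
  have "1 \<le> 1 + x\<^sup>2 / 2 + x\<^sup>2 * (-x) / 2 + (x\<^sup>2)\<^sup>2 / 2"
  proof -
    have "0 \<le> x\<^sup>2 * (-x)" using False by (intro mult_nonneg_nonneg) auto
    then show ?thesis by (smt (verit) divide_nonneg_pos zero_le_power2)
  qed
  also have "\<dots> = ?q * (1 + (-x) + (-x)\<^sup>2 / 2)"
    by (simp add: power2_eq_square field_simps)
  also have "\<dots> \<le> ?q * exp (-x)"
    using False q by (intro mult_left_mono exp_lower_Taylor_quadratic) auto
  finally show ?thesis
    by (simp add: exp_minus field_simps)
qed

text \<open>Chernoff's method: the condition \<open>l * T \<le> 1\<close> places l X in the range of
  the quadratic bound on exp. The parameter \<open>l\<close> is left free so that the caller can
  balance boundedness against the second moment.\<close>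

lemma (in prob_space) PiM_iid_upper_tail:
  fixes X :: "'a \<Rightarrow> real" and D :: nat and l t :: real
  assumes X[measurable]: "X \<in> borel_measurable M"
    and bound: "\<And>w. \<bar>X w\<bar> \<le> T"
    and centred: "expectation X = 0"
    and second_moment: "expectation (\<lambda>w. (X w)\<^sup>2) \<le> v"
    and l: "0 \<le> l" "l * T \<le> 1"
  shows "measure (PiM {..<D} (\<lambda>_. M)) {w \<in> space (PiM {..<D} (\<lambda>_. M)). D * t \<le> (\<Sum>j<D. X (w j))}
       \<le> exp (- (D * (l * t - l\<^sup>2 * v)))"
proof -
  let ?P = "PiM {..<D} (\<lambda>_. M)"
  interpret P: product_prob_space "\<lambda>_. M" "{..<D}"
    by unfold_locales
  have lX: "l * X w \<le> 1" for w
    using mult_left_mono[of "X w" T l] bound[of w] l by (smt (verit))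
  have T0: "0 \<le> T" using bound by (meson abs_ge_zero order_trans)
  have [simp]: "integrable M X"
    by (rule integrable_const_bound[of _ T]) (auto simp: bound)
  have [simp]: "integrable M (\<lambda>w. (X w)\<^sup>2)"
    by (rule integrable_const_bound[of _ "T\<^sup>2"]) (auto simp: bound intro!: abs_le_square_iff[THEN iffD1] order_trans[OF bound])
  have int: "integrable M (\<lambda>w. exp (l * X w))"
    by (rule integrable_const_bound[of _ "exp 1"]) (auto simp: lX)
  have "expectation (\<lambda>w. exp (l * X w)) \<le> expectation (\<lambda>w. 1 + l * X w + l\<^sup>2 * (X w)\<^sup>2)"
    using int exp_le_quadratic[OF lX] by (intro integral_mono) (auto simp: power_mult_distrib)
  also have "\<dots> = 1 + l\<^sup>2 * expectation (\<lambda>w. (X w)\<^sup>2)"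
    using centred by (simp add: prob_space)
  also have "\<dots> \<le> 1 + l\<^sup>2 * v"
    using second_moment by (simp add: mult_left_mono)
  also have "\<dots> \<le> exp (l\<^sup>2 * v)" by (rule exp_ge_add_one_self)
  finally have mgf: "expectation (\<lambda>w. exp (l * X w)) \<le> exp (l\<^sup>2 * v)" .
  have intP: "integrable ?P (\<lambda>w. \<Prod>j<D. exp (l * X (w j)))"
    by (rule P.product_integrable_prod) (use int in auto)
  have "integral\<^sup>L ?P (\<lambda>w. \<Prod>j<D. exp (l * X (w j))) = (\<Prod>j<D. expectation (\<lambda>w. exp (l * X w)))"
    by (rule P.product_integral_prod) (use int in auto)
  also have "\<dots> \<le> exp (D * (l\<^sup>2 * v))"
    using mgf by (simp add: exp_of_nat_mult power_mono)
  finally have E: "integral\<^sup>L ?P (\<lambda>w. \<Prod>j<D. exp (l * X (w j))) \<le> exp (D * (l\<^sup>2 * v))" .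
  have "measure ?P {w \<in> space ?P. D * t \<le> (\<Sum>j<D. X (w j))}
      \<le> measure ?P {w \<in> space ?P. exp (l * (D * t)) \<le> (\<Prod>j<D. exp (l * X (w j)))}"
    using l by (intro P.finite_measure_mono)
      (auto simp: exp_sum[symmetric] sum_distrib_left[symmetric] intro!: mult_left_mono)
  also have "\<dots> \<le> integral\<^sup>L ?P (\<lambda>w. \<Prod>j<D. exp (l * X (w j))) / exp (l * (D * t))"
    by (rule integral_Markov_inequality_measure[where A="{}"]) (auto intro!: intP prod_nonneg AE_I2)
  also have "\<dots> \<le> exp (D * (l\<^sup>2 * v)) / exp (l * (D * t))"
    by (intro divide_right_mono E) auto
  also have "\<dots> = exp (- (D * (l * t - l\<^sup>2 * v)))"
    by (simp add: exp_diff[symmetric] algebra_simps)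
  finally show ?thesis .
qed

text \<open>Meant for the part removed by truncation. The bound does not improve with
  \<open>D\<close>, which is acceptable because that part already has mean of order
  \<delta>^2.\<close>

lemma (in prob_space) PiM_iid_markov:
  fixes W :: "'a \<Rightarrow> real" and D :: nat and t :: real
  assumes W: "integrable M W" "\<And>w. 0 \<le> W w" and t: "0 < t" and D: "0 < D"
  shows "measure (PiM {..<D} (\<lambda>_. M)) {w \<in> space (PiM {..<D} (\<lambda>_. M)). D * t \<le> (\<Sum>j<D. W (w j))}
       \<le> expectation W / t"
proof -
  let ?P = "PiM {..<D} (\<lambda>_. M)"
  interpret P: product_prob_space "\<lambda>_. M" "{..<D}"
    by unfold_locales
  have [measurable]: "W \<in> borel_measurable M" using W by auto
  have d: "distr ?P M (\<lambda>w. w j) = M" if "j < D" for j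
    using that by (intro distr_PiM_component) (auto simp: prob_space_axioms)
  have i: "integrable ?P (\<lambda>w. W (w j))" and e: "integral\<^sup>L ?P (\<lambda>w. W (w j)) = expectation W" if "j < D" for j
  proof -
    have "integrable (distr ?P M (\<lambda>w. w j)) W" using W d[OF that] by simp
    then show "integrable ?P (\<lambda>w. W (w j))"
      using that by (subst (asm) integrable_distr_eq) auto
    have "expectation W = integral\<^sup>L (distr ?P M (\<lambda>w. w j)) W" by (simp add: d[OF that])
    also have "\<dots> = integral\<^sup>L ?P (\<lambda>w. W (w j))"
      using that by (subst integral_distr) auto
    finally show "integral\<^sup>L ?P (\<lambda>w. W (w j)) = expectation W" ..
  qed
  have "measure ?P {w \<in> space ?P. D * t \<le> (\<Sum>j<D. W (w j))} \<le> integral\<^sup>L ?P (\<lambda>w. \<Sum>j<D. W (w j)) / (D * t)"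
    by (rule integral_Markov_inequality_measure[where A="{}"]) (auto intro: i W sum_nonneg simp: t D)
  also have "integral\<^sup>L ?P (\<lambda>w. \<Sum>j<D. W (w j)) = D * expectation W"
    using i e by simp
  finally show ?thesis using D by simp
qed

text \<open>Truncation at \<open>T\<close>, the square of s ln(1/\<delta>). The constant
  \<open>s\<close> is large enough that the removed part has mean at most \<delta>^2 / 8, and
  \<open>v\<close> bounds the second moment of the rest. The two conditions on \<open>D\<close> are
  16 T ln(1/\<delta>) / \<epsilon> and 128 v ln(1/\<delta>) / \<epsilon>^2.\<close>

lemma (in prob_space) PiM_mean_concentration:
  fixes Y :: "'a \<Rightarrow> real" and b m :: real and D :: nat
  defines "s \<equiv> 2 * (2 + max 0 (ln (64 * m / b\<^sup>2))) / b" and "v \<equiv> 24 * m / b^4"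
  assumes Y[measurable]: "Y \<in> borel_measurable M"
    and Y0: "\<And>w. 0 \<le> Y w"
    and EY: "expectation Y = 1"
    and exp_sqrt: "integrable M (\<lambda>w. exp (b * sqrt (Y w)))" "expectation (\<lambda>w. exp (b * sqrt (Y w))) \<le> m"
    and b: "0 < b"
    and \<delta>: "0 < \<delta>" "\<delta> \<le> \<epsilon>" "\<epsilon> \<le> 1/8"
    and D1: "16 * s\<^sup>2 * (1 / \<epsilon>) * ln (1/\<delta>) ^ 3 \<le> real D"
    and D2: "128 * v * (1 / \<epsilon>\<^sup>2) * ln (1/\<delta>) \<le> real D"
  shows "1 - \<delta> \<le> measure (PiM {..<D} (\<lambda>_. M))
      {w \<in> space (PiM {..<D} (\<lambda>_. M)). \<bar>(\<Sum>j<D. Y (w j)) / D - 1\<bar> \<le> \<epsilon>}"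
proof -
  let ?P = "PiM {..<D} (\<lambda>_. M)"
  interpret P: product_prob_space "\<lambda>_. M" "{..<D}"
    by unfold_locales
  define L where "L = ln (1/\<delta>)"
  define k where "k = max 0 (ln (64 * m / b\<^sup>2))"
  define T where "T = (s * L)\<^sup>2"
  define Z where "Z w = (if Y w \<le> T then Y w else 0)" for w
  have \<epsilon>: "0 < \<epsilon>" using \<delta> by auto
  have L1: "1 \<le> L"
  proof -
    have "exp 1 \<le> (1::real) + 1 + 1\<^sup>2" by (rule exp_bound) auto
    also have "\<dots> \<le> 1 / \<delta>" using \<delta> by (simp add: field_simps)
    finally show ?thesis unfolding L_def using \<delta> by (subst ln_ge_iff) auto
  qed
  have e_L: "exp (- L) = \<delta>" unfolding L_def using \<delta> by (simp add: ln_div)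
  have m1: "1 \<le> m"
  proof -
    have "expectation (\<lambda>w. 1) \<le> expectation (\<lambda>w. exp (b * sqrt (Y w)))"
      using exp_sqrt b Y0 by (intro integral_mono) auto
    then show ?thesis using exp_sqrt by (simp add: prob_space)
  qed
  have k0: "0 \<le> k" by (simp add: k_def)
  have s: "s = 2 * (2 + k) / b" "0 < s" using b k0 by (auto simp: s_def k_def)
  have v0: "0 < v" using m1 b by (simp add: v_def)
  have T0: "0 < T" unfolding T_def using s(2) L1 by (intro zero_less_power mult_pos_pos) auto
  have Zm[measurable]: "Z \<in> borel_measurable M" unfolding Z_def by measurable
  have Z0: "0 \<le> Z w" "Z w \<le> T" "Z w \<le> Y w" for w using Y0[of w] T0 by (auto simp: Z_def)
  have sq: "x\<^sup>2 \<le> 8 / b\<^sup>2 * exp (b * x / 2)" if "0 \<le> x" for x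
  proof -
    have "(b * x / 2)\<^sup>2 / 2 \<le> exp (b * x / 2)"
      using exp_lower_Taylor_quadratic[of "b * x / 2"] that b
      by (smt (verit) divide_nonneg_nonneg mult_nonneg_nonneg)
    then show ?thesis using b by (simp add: field_simps power2_eq_square)
  qed
  \<comment> \<open>A single term of the exponential series; applied to sqrt Y it bounds Y^2 and so
    produces \<open>v\<close>.\<close>
  have four: "x ^ 4 \<le> 24 / b ^ 4 * exp (b * x)" if "0 \<le> x" for x
  proof -
    have "(b * x) ^ 4 /\<^sub>R fact 4 = (\<Sum>n\<in>{4}. (b * x) ^ n /\<^sub>R fact n)" by simp
    also have "\<dots> \<le> (\<Sum>n. (b * x) ^ n /\<^sub>R fact n)"
      using that b by (intro sum_le_suminf summable_exp_generic) auto
    also have "\<dots> = exp (b * x)" by (simp add: exp_def)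
    finally show ?thesis using b by (simp add: field_simps fact_numeral power_mult_distrib)
  qed
  have Ysq: "(Y w)\<^sup>2 \<le> 24 / b ^ 4 * exp (b * sqrt (Y w))" for w
  proof -
    have "sqrt (Y w) ^ 4 = (sqrt (Y w) ^ 2)\<^sup>2" by simp
    then have "sqrt (Y w) ^ 4 = (Y w)\<^sup>2" using Y0 by simp
    then show ?thesis using four[of "sqrt (Y w)"] Y0 by simp
  qed
  have [simp]: "integrable M Y" using EY by (metis not_integrable_integral_eq zero_neq_one)
  have [simp]: "integrable M Z"
    by (rule integrable_const_bound[of _ T]) (auto simp: Z0)
  have [simp]: "integrable M (\<lambda>w. (Z w)\<^sup>2)"
    by (rule integrable_const_bound[of _ "T\<^sup>2"]) (auto simp: Z0 intro!: power_mono)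
  have EZ2: "expectation (\<lambda>w. (Z w)\<^sup>2) \<le> v"
  proof -
    have "(Z w)\<^sup>2 \<le> 24 / b ^ 4 * exp (b * sqrt (Y w))" for w
      using Z0 by (intro order_trans[OF _ Ysq] power_mono) auto
    then have "expectation (\<lambda>w. (Z w)\<^sup>2) \<le> expectation (\<lambda>w. 24 / b ^ 4 * exp (b * sqrt (Y w)))"
      using exp_sqrt by (intro integral_mono) auto
    also have "\<dots> \<le> 24 / b^4 * m" unfolding integral_mult_right_zero
      using exp_sqrt b by (intro mult_left_mono) auto
    finally show ?thesis by (simp add: v_def)
  qed
  \<comment> \<open>The quadratic growth uses only half of the exponent b sqrt Y. Above
    \<open>T\<close> the other half is at least (2 + k) L and becomes the decay factor.\<close>
  have tail: "Y w - Z w \<le> 8 / b\<^sup>2 * exp (- ((2 + k) * L)) * exp (b * sqrt (Y w))" for w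
  proof (cases "Y w \<le> T")
    case True then show ?thesis by (simp add: Z_def)
  next
    case False
    let ?u = "sqrt (Y w)"
    have "s * L \<le> ?u" using False unfolding T_def by (intro real_le_rsqrt) simp
    then have "b * (s * L) \<le> b * ?u" using b by simp
    moreover have "b * (s * L) = 2 * ((2 + k) * L)" using b by (simp add: s)
    ultimately have le: "(2 + k) * L \<le> b * ?u / 2" by simp
    have "Y w - Z w = ?u\<^sup>2" using False Y0 by (simp add: Z_def)
    also have "\<dots> \<le> 8 / b\<^sup>2 * exp (b * ?u / 2)" using Y0 by (intro sq) auto
    also have "\<dots> \<le> 8 / b\<^sup>2 * exp (- ((2 + k) * L) + b * ?u)" using le by (intro mult_left_mono) auto
    finally show ?thesis unfolding exp_add by simp
  qed
  \<comment> \<open>Two copies of L produce \<delta>^2; the surplus k L, with L \<ge> 1, absorbs the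
    constant 64 m / b^2.\<close>
  have ek: "exp (- ((2 + k) * L)) \<le> \<delta>\<^sup>2 * (b\<^sup>2 / (64 * m))"
  proof -
    have "exp (- ((2 + k) * L)) = exp (- L) * exp (- L) * exp (- (k * L))"
      by (simp add: exp_add[symmetric] algebra_simps)
    also have "\<dots> = \<delta>\<^sup>2 * exp (- (k * L))" by (simp add: e_L power2_eq_square)
    also have "\<dots> \<le> \<delta>\<^sup>2 * exp (- ln (64 * m / b\<^sup>2))"
    proof -
      have "ln (64 * m / b\<^sup>2) \<le> k" by (simp add: k_def)
      also have "\<dots> \<le> k * L" using k0 L1 by (simp add: mult_le_cancel_left1)
      finally show ?thesis by (intro mult_left_mono) auto
    qed
    also have "exp (- ln (64 * m / b\<^sup>2)) = b\<^sup>2 / (64 * m)"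
      using m1 b by (simp add: exp_minus)
    finally show ?thesis .
  qed
  have EYZ: "expectation (\<lambda>w. Y w - Z w) \<le> \<delta>\<^sup>2 / 8"
  proof -
    have "expectation (\<lambda>w. Y w - Z w)
        \<le> expectation (\<lambda>w. 8 / b\<^sup>2 * exp (- ((2 + k) * L)) * exp (b * sqrt (Y w)))"
      using exp_sqrt by (intro integral_mono tail) auto
    also have "\<dots> = 8 / b\<^sup>2 * exp (- ((2 + k) * L)) * expectation (\<lambda>w. exp (b * sqrt (Y w)))"
      by simp
    also have "\<dots> \<le> 8 / b\<^sup>2 * (\<delta>\<^sup>2 * (b\<^sup>2 / (64 * m))) * m"
      using ek exp_sqrt m1 by (intro mult_mono mult_left_mono) auto
    also have "\<dots> = \<delta>\<^sup>2 / 8" using b m1 by (simp add: field_simps)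
    finally show ?thesis .
  qed
  define \<mu> where "\<mu> = expectation Z"
  \<comment> \<open>One factor \<delta> is traded for \<epsilon> so that Markov's inequality at
    level \<epsilon> / 2 leaves \<delta> / 4.\<close>
  have \<delta>2: "\<delta>\<^sup>2 \<le> \<delta> * \<epsilon>" using \<delta> by (simp add: power2_eq_square)
  have "\<delta> * \<epsilon> \<le> \<delta> * (1/8)" using \<delta> by (intro mult_left_mono) auto
  with \<delta>2 have \<delta>2': "\<delta>\<^sup>2 \<le> \<delta> / 8" by simp
  have \<mu>: "1 - \<epsilon> / 8 \<le> \<mu>" "\<mu> \<le> 1"
  proof -
    have "1 - \<mu> \<le> \<delta>\<^sup>2 / 8" using EYZ EY by (simp add: \<mu>_def)
    then show "1 - \<epsilon> / 8 \<le> \<mu>" using \<delta>2' \<delta> by linarith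
    have "\<mu> \<le> expectation Y" unfolding \<mu>_def using Z0 by (intro integral_mono) auto
    then show "\<mu> \<le> 1" by (simp add: EY)
  qed
  have \<mu>0: "0 \<le> \<mu>" unfolding \<mu>_def using Z0 by simp
  have \<mu>T: "\<mu> \<le> T" 
  proof -
    have "\<mu> \<le> expectation (\<lambda>_. T)" unfolding \<mu>_def using Z0 by (intro integral_mono) auto
    then show ?thesis by (simp add: prob_space)
  qed
  have var: "expectation (\<lambda>w. (Z w - \<mu>)\<^sup>2) \<le> v"
  proof -
    have "expectation (\<lambda>w. (Z w - \<mu>)\<^sup>2) = expectation (\<lambda>w. (Z w)\<^sup>2) - \<mu>\<^sup>2"
      unfolding \<mu>_def by (rule variance_eq) auto
    then show ?thesis using EZ2 zero_le_power2[of \<mu>] by linarith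
  qed
  \<comment> \<open>The first cap gives \<open>l * T \<le> 1\<close>; the second keeps the quadratic
    loss below half of the linear gain l \<epsilon> / 4. Each hypothesis on \<open>D\<close> serves
    the case in which its cap is the smaller one.\<close>
  define l where "l = min (1 / T) (\<epsilon> / (8 * v))"
  have l0: "0 < l" using T0 \<epsilon> v0 by (simp add: l_def)
  have lT: "l * T \<le> 1" using T0 by (auto simp: l_def min_def field_simps)
  have lv: "l * v \<le> \<epsilon> / 8" using v0 by (auto simp: l_def min_def field_simps)
  have lD: "16 * L \<le> D * l * \<epsilon>"
  proof (cases "1 / T \<le> \<epsilon> / (8 * v)")
    case True
    have "16 * T * L / \<epsilon> \<le> D" using D1 by (simp add: T_def L_def power2_eq_square power3_eq_cube field_simps)
    then show ?thesis using True T0 \<epsilon> by (simp add: l_def min_def field_simps)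
  next
    case False
    have "128 * v * L / \<epsilon>\<^sup>2 \<le> D" using D2 by (simp add: L_def)
    then show ?thesis using False v0 \<epsilon> by (simp add: l_def min_def field_simps power2_eq_square)
  qed
  have D0: "0 < D"
    using lD L1 by (cases D) auto
  have ex: "exp (- (D * (l * (\<epsilon>/4) - l\<^sup>2 * v))) \<le> \<delta> / 8"
  proof -
    have "l * (l * v) \<le> l * (\<epsilon> / 8)" using lv l0 by (intro mult_left_mono) auto
    then have "l * \<epsilon> / 8 \<le> l * (\<epsilon>/4) - l\<^sup>2 * v" by (simp add: power2_eq_square mult_ac)
    then have "D * (l * \<epsilon> / 8) \<le> D * (l * (\<epsilon>/4) - l\<^sup>2 * v)" by (intro mult_left_mono) auto
    then have "2 * L \<le> D * (l * (\<epsilon>/4) - l\<^sup>2 * v)" using lD by (simp add: field_simps)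
    then have "exp (- (D * (l * (\<epsilon>/4) - l\<^sup>2 * v))) \<le> exp (- L + - L)" by simp
    also have "\<dots> = \<delta>\<^sup>2" unfolding exp_add e_L by (simp add: power2_eq_square)
    finally show ?thesis using \<delta>2' by simp
  qed
  \<comment> \<open>Upward the errors add to \<epsilon>/2 + \<epsilon>/4, since \<open>\<mu>\<close>
    is at most 1. Downward Z \<le> Y makes the removed part harmless, and only \<epsilon>/4 plus the
    bias \<epsilon>/8 of \<open>\<mu>\<close> remains.\<close>
  define A1 where "A1 = {w \<in> space ?P. D * (\<epsilon>/2) \<le> (\<Sum>j<D. Y (w j) - Z (w j))}"
  define A2 where "A2 = {w \<in> space ?P. D * (\<epsilon>/4) \<le> (\<Sum>j<D. Z (w j) - \<mu>)}"
  define A3 where "A3 = {w \<in> space ?P. D * (\<epsilon>/4) \<le> (\<Sum>j<D. \<mu> - Z (w j))}"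
  define G where "G = {w \<in> space ?P. \<bar>(\<Sum>j<D. Y (w j)) / D - 1\<bar> \<le> \<epsilon>}"
  have sets[measurable]: "A1 \<in> sets ?P" "A2 \<in> sets ?P" "A3 \<in> sets ?P" "G \<in> sets ?P"
    unfolding A1_def A2_def A3_def G_def by measurable
  have A1: "measure ?P A1 \<le> \<delta> / 4"
  proof -
    have "measure ?P A1 \<le> expectation (\<lambda>w. Y w - Z w) / (\<epsilon> / 2)"
      unfolding A1_def using Z0 \<epsilon> D0 by (intro PiM_iid_markov[where W="\<lambda>w. Y w - Z w"]) auto
    also have "\<dots> \<le> (\<delta> * \<epsilon> / 8) / (\<epsilon> / 2)"
      using EYZ \<delta>2 \<epsilon> by (intro divide_right_mono) auto
    finally show ?thesis using \<epsilon> by simp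
  qed
  have bnd: "\<bar>Z w - \<mu>\<bar> \<le> T" for w using Z0[of w] \<mu>T \<mu>0 by auto
  have A2: "measure ?P A2 \<le> \<delta> / 8"
    unfolding A2_def
    by (rule order_trans[OF PiM_iid_upper_tail[where X="\<lambda>w. Z w - \<mu>" and T=T and l=l and v=v]])
       (use bnd var l0 lT ex in \<open>auto simp: \<mu>_def prob_space\<close>)
  have A3: "measure ?P A3 \<le> \<delta> / 8"
    unfolding A3_def
    by (rule order_trans[OF PiM_iid_upper_tail[where X="\<lambda>w. \<mu> - Z w" and T=T and l=l and v=v]])
       (use bnd var l0 lT ex in \<open>auto simp: \<mu>_def prob_space abs_minus_commute power2_commute\<close>)
  have sub: "space ?P - G \<subseteq> A1 \<union> (A2 \<union> A3)"
  proof
    fix w assume w: "w \<in> space ?P - G"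
    show "w \<in> A1 \<union> (A2 \<union> A3)"
    proof (rule ccontr)
      assume "w \<notin> A1 \<union> (A2 \<union> A3)"
      then have 1: "(\<Sum>j<D. Y (w j)) - (\<Sum>j<D. Z (w j)) < D * (\<epsilon>/2)"
        and 2: "(\<Sum>j<D. Z (w j)) - D * \<mu> < D * (\<epsilon>/4)"
        and 3: "D * \<mu> - (\<Sum>j<D. Z (w j)) < D * (\<epsilon>/4)"
        using w by (auto simp: A1_def A2_def A3_def sum_subtractf)
      have 4: "(\<Sum>j<D. Z (w j)) \<le> (\<Sum>j<D. Y (w j))" using Z0 by (intro sum_mono) auto
      have 5: "D * (1 - \<epsilon>/8) \<le> D * \<mu>" "D * \<mu> \<le> D * (1::real)"
        using \<mu> mult_left_mono[OF \<mu>(1), of "real D"] mult_left_mono[OF \<mu>(2), of "real D"] by simp_all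
      have 6: "0 < D * \<epsilon>" using D0 \<epsilon> by simp
      have "\<bar>(\<Sum>j<D. Y (w j)) - D\<bar> \<le> D * \<epsilon>"
        using 1 2 3 4 5 6 by (simp add: algebra_simps abs_le_iff)
      moreover have "\<bar>(\<Sum>j<D. Y (w j)) / D - 1\<bar> = \<bar>(\<Sum>j<D. Y (w j)) - D\<bar> / D"
        using D0 by (simp add: diff_divide_distrib[symmetric] abs_divide[symmetric] field_simps)
      ultimately have "\<bar>(\<Sum>j<D. Y (w j)) / D - 1\<bar> \<le> \<epsilon>"
        using D0 by (simp add: field_simps)
      then show False using w by (simp add: G_def)
    qed
  qed
  have "1 - measure ?P G = measure ?P (space ?P - G)"
    by (rule P.prob_compl[symmetric]) measurable
  also have "\<dots> \<le> measure ?P (A1 \<union> (A2 \<union> A3))"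
    using sub by (intro P.finite_measure_mono) auto
  also have "\<dots> \<le> measure ?P A1 + (measure ?P A2 + measure ?P A3)"
    by (intro order_trans[OF measure_Un_le] add_left_mono measure_Un_le) auto
  also have "\<dots> \<le> \<delta>" using A1 A2 A3 \<delta> by simp
  finally show ?thesis unfolding G_def by simp
qed

section \<open>Random Fourier features\<close>

text \<open>On a coordinate axis every monomial involving another coordinate vanishes, so the
  multivariate sum collapses to the multi-indices supported at \<open>b\<close>. One radius serves
  all axes.\<close>

lemma analytic_at_origin_axis:
  fixes K :: "'a::euclidean_space \<Rightarrow> real"
  assumes "analytic_at_origin K"
  obtains r c where "0 < r"
    and "\<And>b t. b \<in> Basis \<Longrightarrow> \<bar>t\<bar> < r \<Longrightarrow> (\<lambda>n. c b n * t ^ n) sums K (t *\<^sub>R b)"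
proof -
  obtain r c where r: "0 < r" and c: "\<And>x. l1_norm x < r \<Longrightarrow>
      ((\<lambda>\<alpha>. c \<alpha> * monomial_at \<alpha> x) has_sum K x) multi_indices"
    using assms unfolding analytic_at_origin_def by blast
  define e where "e b n b' = (if b' = b then n else 0)" for b b' :: 'a and n :: nat
  show ?thesis
  proof (rule that[OF r])
    fix b :: 'a and t :: real
    assume b: "b \<in> Basis" and t: "\<bar>t\<bar> < r"
    have inj: "inj (e b)" by (rule injI) (metis e_def)
    have sub: "range (e b) \<subseteq> multi_indices"
      using b by (auto simp: multi_indices_def e_def)
    have "l1_norm (t *\<^sub>R b) = (\<Sum>b'\<in>Basis. if b' = b then \<bar>t\<bar> else 0)"
      unfolding l1_norm_def using b by (intro sum.cong) (auto simp: inner_Basis)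
    also have "\<dots> = \<bar>t\<bar>" using b by simp
    finally have sum: "((\<lambda>\<alpha>. c \<alpha> * monomial_at \<alpha> (t *\<^sub>R b)) has_sum K (t *\<^sub>R b)) multi_indices"
      using t by (intro c) simp
    have zero: "monomial_at \<alpha> (t *\<^sub>R b) = 0" if "\<alpha> \<in> multi_indices - range (e b)" for \<alpha>
    proof -
      have "\<alpha> \<noteq> e b (\<alpha> b)" using that by blast
      then obtain b' where b': "b' \<noteq> b" "\<alpha> b' \<noteq> 0" by (auto simp: fun_eq_iff e_def split: if_splits)
      with that have "b' \<in> Basis" by (auto simp: multi_indices_def)
      then show ?thesis unfolding monomial_at_def using b b'
        by (intro prod_zero bexI[of _ b']) (auto simp: inner_Basis)
    qed
    have mono: "monomial_at (e b n) (t *\<^sub>R b) = t ^ n" for n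
    proof -
      have "monomial_at (e b n) (t *\<^sub>R b) = (\<Prod>b'\<in>Basis. if b' = b then t ^ n else 1)"
        unfolding monomial_at_def e_def using b by (intro prod.cong) (auto simp: inner_Basis)
      then show ?thesis using b by simp
    qed
    have "((\<lambda>\<alpha>. c \<alpha> * monomial_at \<alpha> (t *\<^sub>R b)) has_sum K (t *\<^sub>R b)) (range (e b))"
      using sum sub zero by (subst has_sum_cong_neutral[where T = multi_indices]) auto
    then have "((\<lambda>n. c (e b n) * t ^ n) has_sum K (t *\<^sub>R b)) UNIV"
      by (subst (asm) has_sum_reindex[OF inj]) (simp add: o_def mono)
    then show "(\<lambda>n. c (e b n) * t ^ n) sums K (t *\<^sub>R b)" by (rule has_sum_imp_sums)
  qed
qed

text \<open>The norm is at most the dimension times the largest coordinate, so dividing the rate by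
  the dimension lets a single summand dominate.\<close>

lemma exp_norm_integrable:
  fixes M :: "'a::euclidean_space measure"
  assumes sets: "sets M = sets borel" and a: "0 \<le> a"
    and int: "\<And>b. b \<in> Basis \<Longrightarrow> integrable M (\<lambda>w. exp (a * \<bar>w \<bullet> b\<bar>))"
  shows "integrable M (\<lambda>w. exp (a / DIM('a) * norm w))"
proof -
  note [measurable_cong] = sets
  have "integrable M (\<lambda>w. \<Sum>b\<in>Basis. exp (a * \<bar>w \<bullet> b\<bar>))" using int by simp
  then show ?thesis
  proof (rule Bochner_Integration.integrable_bound)
    have "exp (a / DIM('a) * norm w) \<le> (\<Sum>b\<in>Basis. exp (a * \<bar>w \<bullet> b\<bar>))" for w :: 'a
    proof -
      have "Max ((\<lambda>b. \<bar>w \<bullet> b\<bar>) ` Basis) \<in> (\<lambda>b. \<bar>w \<bullet> b\<bar>) ` Basis" by (intro Max_in) auto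
      then obtain b where b: "b \<in> Basis" "\<bar>w \<bullet> b\<bar> = Max ((\<lambda>b. \<bar>w \<bullet> b\<bar>) ` Basis)" by force
      have "norm w \<le> (\<Sum>b'\<in>Basis. \<bar>w \<bullet> b'\<bar>)" by (rule norm_le_l1)
      also have "\<dots> \<le> (\<Sum>b'\<in>(Basis::'a set). \<bar>w \<bullet> b\<bar>)" unfolding b(2) by (intro sum_mono Max_ge) auto
      finally have "norm w / DIM('a) \<le> \<bar>w \<bullet> b\<bar>" by (simp add: field_simps)
      then have "exp (a / DIM('a) * norm w) \<le> exp (a * \<bar>w \<bullet> b\<bar>)"
        using mult_left_mono[OF _ a] by fastforce
      also have "\<dots> \<le> (\<Sum>b\<in>Basis. exp (a * \<bar>w \<bullet> b\<bar>))"
        using b by (intro member_le_sum) auto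
      finally show ?thesis .
    qed
    then show "AE w in M. norm (exp (a / DIM('a) * norm w)) \<le> norm (\<Sum>b\<in>Basis. exp (a * \<bar>w \<bullet> b\<bar>))"
      by (intro AE_I2) (simp add: sum_nonneg)
  qed measurable
qed

lemma sum_lessThan_double: "(\<Sum>j<2 * D. g j) = (\<Sum>i<D. g (2 * i) + g (Suc (2 * i)))"
  for g :: "nat \<Rightarrow> 'b::comm_monoid_add"
  by (induction D) (auto simp: add.assoc)

text \<open>Each sine-cosine pair is a point on the unit circle, and a squared chord depends only on
  the difference of the angles. For D = 0 both sides are 0, by the convention for division by
  zero.\<close>

lemma dist_rff_eq:
  "dist_rff D w x y = sqrt ((\<Sum>i<D. 2 * (1 - cos (w i \<bullet> (x - y)))) / D)"
proof -
  have "(\<Sum>j<2 * D. (rff_map D w x j - rff_map D w y j)\<^sup>2)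
      = (\<Sum>i<D. (1 / D) * ((sin (w i \<bullet> x) - sin (w i \<bullet> y))\<^sup>2 + (cos (w i \<bullet> x) - cos (w i \<bullet> y))\<^sup>2))"
    unfolding sum_lessThan_double
    by (intro sum.cong) (auto simp: rff_map_def right_diff_distrib[symmetric] power_mult_distrib distrib_left)
  also have "\<dots> = (\<Sum>i<D. (1 / D) * (2 * (1 - cos (w i \<bullet> (x - y)))))"
  proof (intro sum.cong refl arg_cong2[where f=times])
    fix i
    have "(sin u - sin v)\<^sup>2 + (cos u - cos v)\<^sup>2 = 2 * (1 - cos (u - v))" for u v :: real
      using sin_cos_squared_add[of u] sin_cos_squared_add[of v]
      by (simp add: cos_diff power2_eq_square algebra_simps)
    then show "(sin (w i \<bullet> x) - sin (w i \<bullet> y))\<^sup>2 + (cos (w i \<bullet> x) - cos (w i \<bullet> y))\<^sup>2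
        = 2 * (1 - cos (w i \<bullet> (x - y)))" by (simp add: inner_diff_right)
  qed
  also have "\<dots> = (\<Sum>i<D. 2 * (1 - cos (w i \<bullet> (x - y)))) / D"
    by (simp add: sum_divide_distrib)
  finally show ?thesis by (simp add: dist_rff_def)
qed

text \<open>Carries a relative error of the squared distance over to the distance without
  loss.\<close>

lemma abs_sqrt_minus_one_le:
  fixes A :: real
  assumes "0 \<le> A"
  shows "\<bar>sqrt A - 1\<bar> \<le> \<bar>A - 1\<bar>"
proof -
  have "A - 1 = (sqrt A - 1) * (sqrt A + 1)"
    using assms by (simp add: algebra_simps)
  then have "\<bar>A - 1\<bar> = \<bar>sqrt A - 1\<bar> * (sqrt A + 1)"
    using assms by (simp add: abs_mult)
  moreover have "\<bar>sqrt A - 1\<bar> * 1 \<le> \<bar>sqrt A - 1\<bar> * (sqrt A + 1)"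
    using assms by (intro mult_left_mono) auto
  ultimately show ?thesis by simp
qed

text \<open>The factor min 1 |z|^2 matches the lower bound on the gap, so the quotient of the two is
  bounded independently of z.\<close>

lemma one_minus_cos_inner_le:
  fixes w z :: "'a::real_inner"
  shows "1 - cos (w \<bullet> z) \<le> 2 * (1 + (norm w)\<^sup>2) * min 1 ((norm z)\<^sup>2)"
proof (cases "(norm z)\<^sup>2 \<le> 1")
  case True
  have "1 - cos (w \<bullet> z) = 2 * (sin (w \<bullet> z / 2))\<^sup>2"
    using cos_double_sin[of "w \<bullet> z / 2"] by simp
  also have "\<dots> \<le> 2 * (w \<bullet> z / 2)\<^sup>2"
    using abs_sin_x_le_abs_x[of "w \<bullet> z / 2"] by (simp add: abs_le_square_iff[symmetric])
  also have "\<dots> \<le> 2 * (norm w * norm z)\<^sup>2"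
    using Cauchy_Schwarz_ineq2[of w z] by (simp add: abs_le_square_iff[symmetric] abs_mult)
  also have "\<dots> \<le> 2 * (1 + (norm w)\<^sup>2) * (norm z)\<^sup>2"
    by (simp add: power_mult_distrib distrib_right)
  finally show ?thesis using True by (simp add: min_def)
next
  case False
  have "1 - cos (w \<bullet> z) \<le> 2" using cos_ge_minus_one[of "w \<bullet> z"] by linarith
  also have "\<dots> \<le> 2 * (1 + (norm w)\<^sup>2)" by simp
  finally show ?thesis using False by (simp add: min_def)
qed

theorem theorem1p2:
  fixes K :: "'a::euclidean_space \<Rightarrow> real"
    and p :: "'a \<Rightarrow> real"
  assumes p_meas: "p \<in> borel_measurable lborel"
    and p_nonneg: "\<And>w. 0 \<le> p w"
    and p_int: "integrable lborel p"
    and p_total: "(\<integral>w. p w \<partial>lborel) = 1"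
    and bochner: "\<And>x. complex_of_real (K x) = (\<integral>w. complex_of_real (p w) * cis (w \<bullet> x) \<partial>lborel)"
    and K0: "K 0 = 1"
    and analytic: "analytic_at_origin K"
  shows "\<exists>C1>0. \<exists>C2>0. \<forall>\<epsilon> \<delta> :: real. \<forall>D :: nat.
           0 < \<delta> \<longrightarrow> \<delta> \<le> \<epsilon> \<longrightarrow> \<epsilon> \<le> 2 powr (-16) \<longrightarrow>
           real D \<ge> max (C1 * (1 / \<epsilon>) * (ln (1 / \<delta>)) ^ 3) (C2 * (1 / \<epsilon>\<^sup>2) * ln (1 / \<delta>)) \<longrightarrow>
           (\<forall>x y :: 'a.
              measure (rff_measure D p)
                {w \<in> space (rff_measure D p).
                   \<bar>dist_rff D w x y - dist_feature K x y\<bar> \<le> \<epsilon> * dist_feature K x y}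
              \<ge> 1 - \<delta>)"
proof -
  define M where "M = density lborel (\<lambda>w. ennreal (p w))"
  have pm[measurable]: "p \<in> borel_measurable borel" using p_meas by simp
  have sets_M[measurable_cong]: "sets M = sets borel" and space_M: "space M = UNIV"
    by (auto simp: M_def)
  interpret prob_space M
  proof
    have "emeasure M (space M) = (\<integral>\<^sup>+w. ennreal (p w) \<partial>lborel)"
      by (simp add: M_def emeasure_density)
    also have "\<dots> = 1" using p_int p_total p_nonneg by (simp add: nn_integral_eq_integral)
    finally show "emeasure M (space M) = 1" .
  qed
  have K_eq: "K x = expectation (\<lambda>w. cos (w \<bullet> x))" for x
  proof -
    have i: "integrable lborel (\<lambda>w. complex_of_real (p w) * cis (w \<bullet> x))"
    proof (rule Bochner_Integration.integrable_bound[OF p_int])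
      show "(\<lambda>w. complex_of_real (p w) * cis (w \<bullet> x)) \<in> borel_measurable lborel"
        unfolding cis_conv_exp by measurable
    qed (simp add: norm_mult)
    have "K x = Re (complex_of_real (K x))" by simp
    also have "\<dots> = (\<integral>w. Re (complex_of_real (p w) * cis (w \<bullet> x)) \<partial>lborel)"
      unfolding bochner using i by (rule integral_Re[symmetric])
    also have "\<dots> = expectation (\<lambda>w. cos (w \<bullet> x))"
      unfolding M_def using p_nonneg by (subst integral_density) auto
    finally show ?thesis .
  qed
  obtain r coeff where r: "0 < r"
    and coeff: "\<And>b t. b \<in> Basis \<Longrightarrow> \<bar>t\<bar> < r \<Longrightarrow> (\<lambda>n. coeff b n * t ^ n) sums K (t *\<^sub>R b)"
    using analytic_at_origin_axis[OF analytic] by blast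
  \<comment> \<open>Half the radius lies strictly inside the interval of convergence; the dimension
    is the cost of passing from coordinates to the norm.\<close>
  define a where "a = r / 2 / DIM('a)"
  have a: "0 < a" using r by (simp add: a_def)
  have exp_int: "integrable M (\<lambda>w. exp (a * norm w))"
    unfolding a_def
  proof (rule exp_norm_integrable)
    fix b :: 'a assume "b \<in> Basis"
    then show "integrable M (\<lambda>w. exp (r / 2 * \<bar>w \<bullet> b\<bar>))"
      using coeff[of b] r
      by (intro power_series_cos_transform_exp_moment[where r = r and c = "coeff b"])
         (auto simp: K_eq finite_measure_axioms)
  qed (use r sets_M in auto)
  obtain c where c: "0 < c" and gap: "\<And>z. c * min 1 ((norm z)\<^sup>2) \<le> 1 - K z"
  proof -
    obtain c where c: "0 < c"
      "\<And>z. c * min 1 ((norm z)\<^sup>2) \<le> (\<integral>w. p w * (1 - cos (w \<bullet> z)) \<partial>lborel)"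
      using spectral_gap[OF pm p_nonneg p_int] p_total by auto
    have "(\<integral>w. p w * (1 - cos (w \<bullet> z)) \<partial>lborel) = 1 - K z" for z
    proof -
      have "(\<integral>w. p w * (1 - cos (w \<bullet> z)) \<partial>lborel) = expectation (\<lambda>w. 1 - cos (w \<bullet> z))"
        unfolding M_def using p_nonneg by (subst integral_density) auto
      also have "\<dots> = 1 - K z" unfolding K_eq
        by (subst Bochner_Integration.integral_diff)
           (auto simp: prob_space intro!: integrable_const_bound[of _ 1])
      finally show ?thesis .
    qed
    with c show ?thesis by (intro that[of c]) auto
  qed
  \<comment> \<open>Chosen so that b sqrt Y \<le> a (1 + |w|) for every z. Hence \<open>b\<close>,
    \<open>m\<close>, \<open>s\<close> and \<open>v\<close> are fixed before x, y, \<epsilon>,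
    \<delta> and \<open>D\<close>.\<close>
  define b where "b = a / sqrt (2 / c)"
  define m where "m = expectation (\<lambda>w. exp (a * (1 + norm w)))"
  define s where "s = 2 * (2 + max 0 (ln (64 * m / b\<^sup>2))) / b"
  define v where "v = 24 * m / b ^ 4"
  have b: "0 < b" using a c by (simp add: b_def)
  have m_int: "integrable M (\<lambda>w. exp (a * (1 + norm w)))"
    using exp_int by (simp add: distrib_left exp_add)
  have m: "0 < m"
  proof -
    have "expectation (\<lambda>_. 1) \<le> m"
      unfolding m_def using m_int a by (intro integral_mono) auto
    then show ?thesis by (simp add: prob_space)
  qed
  have main: "1 - \<delta> \<le> measure (rff_measure D p) {w \<in> space (rff_measure D p).
        \<bar>dist_rff D w x y - dist_feature K x y\<bar> \<le> \<epsilon> * dist_feature K x y}"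
    if \<delta>: "0 < \<delta>" "\<delta> \<le> \<epsilon>" "\<epsilon> \<le> 2 powr (-16)"
      and D1: "16 * s\<^sup>2 * (1 / \<epsilon>) * ln (1 / \<delta>) ^ 3 \<le> real D"
      and D2: "128 * v * (1 / \<epsilon>\<^sup>2) * ln (1 / \<delta>) \<le> real D"
    for \<epsilon> \<delta> :: real and D :: nat and x y :: 'a
  proof -
    let ?P = "PiM {..<D} (\<lambda>_. M)"
    have P: "rff_measure D p = ?P" by (simp add: rff_measure_def M_def)
    interpret P: prob_space ?P by (intro prob_space_PiM prob_space_axioms)
    define z where "z = x - y"
    define \<mu> where "\<mu> = 1 - K z"
    have dist_feature: "dist_feature K x y = sqrt (2 * \<mu>)"
      by (simp add: dist_feature_def \<mu>_def z_def)
    show ?thesis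
    \<comment> \<open>For x = y the normalisation by \<open>\<mu>\<close> = 1 - K 0 = 0 is
      meaningless, but both distances vanish.\<close>
    proof (cases "x = y")
      case True
      then have "dist_feature K x y = 0" "\<And>w. dist_rff D w x y = 0"
        by (auto simp: dist_feature_def dist_rff_def K0)
      then show ?thesis unfolding P using \<delta> P.prob_space by simp
    next
      case False
      then have z: "z \<noteq> 0" by (simp add: z_def)
      have gap_z: "c * min 1 ((norm z)\<^sup>2) \<le> \<mu>" using gap by (simp add: \<mu>_def)
      have \<mu>: "0 < \<mu>"
        by (rule less_le_trans[OF _ gap_z]) (use c z in auto)
      define Y where "Y w = (1 - cos (w \<bullet> z)) / \<mu>" for w :: 'a
      have Ym[measurable]: "Y \<in> borel_measurable M" unfolding Y_def by measurable
      have Y0: "0 \<le> Y w" for w using \<mu> by (simp add: Y_def)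
      have EY: "expectation Y = 1"
      proof -
        have "expectation (\<lambda>w. 1 - cos (w \<bullet> z)) = \<mu>" unfolding \<mu>_def K_eq
          by (subst Bochner_Integration.integral_diff)
             (auto simp: prob_space intro!: integrable_const_bound[of _ 1])
        then show ?thesis using \<mu> by (simp add: Y_def[abs_def])
      qed
      \<comment> \<open>The min factor cancels through \<open>gap_z\<close>. Enlarging 1 + |w|^2 to
        (1 + |w|)^2 makes the square root linear in |w|, matching the available exponential
        moment.\<close>
      have bY: "b * sqrt (Y w) \<le> a * (1 + norm w)" for w
      proof -
        have "1 - cos (w \<bullet> z) \<le> 2 / c * (1 + (norm w)\<^sup>2) * (c * min 1 ((norm z)\<^sup>2))"
          using one_minus_cos_inner_le[of w z] c by simp
        also have "\<dots> \<le> 2 / c * (1 + (norm w)\<^sup>2) * \<mu>"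
          using c by (intro mult_left_mono gap_z) auto
        finally have "Y w \<le> 2 / c * (1 + (norm w)\<^sup>2)" using \<mu> by (simp add: Y_def pos_divide_le_eq)
        also have "\<dots> \<le> 2 / c * (1 + norm w)\<^sup>2"
          using c by (intro mult_left_mono) (auto simp: power2_eq_square algebra_simps)
        finally have "sqrt (Y w) \<le> sqrt (2 / c * (1 + norm w)\<^sup>2)" by simp
        also have "\<dots> = sqrt (2 / c) * (1 + norm w)" by (simp only: real_sqrt_mult real_sqrt_abs abs_of_nonneg add_nonneg_nonneg zero_le_one norm_ge_zero)
        finally have "b * sqrt (Y w) \<le> b * (sqrt (2 / c) * (1 + norm w))"
          using b by (intro mult_left_mono) auto
        then show ?thesis using c by (simp add: b_def)
      qed
      have e_int: "integrable M (\<lambda>w. exp (b * sqrt (Y w)))"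
        by (rule Bochner_Integration.integrable_bound[OF m_int]) (use bY in auto)
      have e_le: "expectation (\<lambda>w. exp (b * sqrt (Y w))) \<le> m"
        unfolding m_def using bY by (intro integral_mono e_int m_int) auto
      have "(2::real) powr (-16) \<le> 1 / 8" by (simp add: powr_minus)
      then have \<epsilon>: "\<epsilon> \<le> 1 / 8" using \<delta> by linarith
      have "1 - \<delta> \<le> measure ?P {w \<in> space ?P. \<bar>(\<Sum>j<D. Y (w j)) / D - 1\<bar> \<le> \<epsilon>}"
        by (rule PiM_mean_concentration[OF Ym Y0 EY e_int e_le b \<delta>(1,2) \<epsilon>])
           (use D1 D2 in \<open>simp_all only: s_def v_def\<close>)
      also have "\<dots> \<le> measure ?P {w \<in> space ?P.
          \<bar>dist_rff D w x y - dist_feature K x y\<bar> \<le> \<epsilon> * dist_feature K x y}"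
      proof (rule P.finite_measure_mono)
        show "{w \<in> space ?P. \<bar>(\<Sum>j<D. Y (w j)) / D - 1\<bar> \<le> \<epsilon>} \<subseteq>
          {w \<in> space ?P. \<bar>dist_rff D w x y - dist_feature K x y\<bar> \<le> \<epsilon> * dist_feature K x y}"
        proof safe
          fix w assume w: "\<bar>(\<Sum>j<D. Y (w j)) / D - 1\<bar> \<le> \<epsilon>"
          let ?A = "(\<Sum>j<D. Y (w j)) / D"
          have A: "0 \<le> ?A" using Y0 by (intro divide_nonneg_nonneg sum_nonneg) auto
          have "(\<Sum>i<D. 2 * (1 - cos (w i \<bullet> (x - y)))) = 2 * \<mu> * (\<Sum>j<D. Y (w j))"
            unfolding sum_distrib_left z_def[symmetric] Y_def using \<mu> by (intro sum.cong) auto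
          then have "dist_rff D w x y = sqrt (2 * \<mu> * ?A)" unfolding dist_rff_eq by simp
          also have "\<dots> = dist_feature K x y * sqrt ?A" unfolding dist_feature by (rule real_sqrt_mult)
          finally have "\<bar>dist_rff D w x y - dist_feature K x y\<bar> = \<bar>dist_feature K x y * (sqrt ?A - 1)\<bar>"
            by (simp add: right_diff_distrib)
          also have "\<dots> = dist_feature K x y * \<bar>sqrt ?A - 1\<bar>"
            using \<mu> by (simp add: abs_mult dist_feature)
          also have "\<dots> \<le> dist_feature K x y * \<epsilon>"
            using \<mu> w order_trans[OF abs_sqrt_minus_one_le[OF A]]
            by (intro mult_left_mono) (auto simp: dist_feature)
          finally show "\<bar>dist_rff D w x y - dist_feature K x y\<bar> \<le> \<epsilon> * dist_feature K x y"
            by (simp add: mult.commute)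
        qed
        show "{w \<in> space ?P. \<bar>dist_rff D w x y - dist_feature K x y\<bar> \<le> \<epsilon> * dist_feature K x y} \<in> sets ?P"
          unfolding dist_rff_eq by measurable
      qed
      finally show ?thesis unfolding P .
    qed
  qed
  have "0 < 16 * s\<^sup>2" using b by (simp add: s_def)
  moreover have "0 < 128 * v" using m b by (simp add: v_def)
  ultimately show ?thesis using main by (intro exI[of _ "16 * s\<^sup>2"] exI[of _ "128 * v"] conjI) auto
qed

end
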